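(* Assume that (a) $G_n$ is bounded and continuous on $\mathsf{X}$ for every $n\ge 0$; (b) for every $n\geq 1$ the Markov kernel $\check{M}_n$ on $\mathsf{X}\times\mathsf{X}$ is Feller; (c) $\mathsf{X}\times\mathsf{X}$ is a locally compact and separable metric space. Then for every $n\geq 0$ and every bounded continuous $\varphi:\mathsf{X}\times\mathsf{X}\to\mathbb{R}$, $$\check{\eta}_{n}^{N,M}(\varphi)\to \check{\eta}_{n}^{M}(\varphi)\quad\text{in probability as } N\to\infty .$$
   Context: **Model.** $(\mathsf{X},\mathcal{X})$ is a measurable space (with its Borel $\sigma$-algebra when topological notions are used; $\mathsf{X}\times\mathsf{X}$ carries the product topology and product $\sigma$-algebra). For $n\ge0$, $G_n:\mathsf{X}\to\mathbb{R}_+$ is bounded and measurable. $\eta_0^f,\eta_0^c$ are probability measures on $\mathsf{X}$ and $M_n^f,M_n^c$ ($n\ge1$) are Markov kernels on $\mathsf{X}$. $\check\eta_0$ is a probability measure on $\mathsf{X}\times\mathsf{X}$ with marginals $\eta_0^f$ (first) and $\eta_0^c$ (second), and $\check M_n$ ($n\ge 1$) is a Markov kernel on $\mathsf{X}\times\mathsf{X}$ such that $\check M_n((x,x'),\cdot)$ has marginals $M_n^f(x,\cdot)$ and $M_n^c(x',\cdot)$. Notation: $\mu(\varphi)=\int\varphi\,d\mu$, $K(\varphi)(x)=\int\varphi(y)K(x,dy)$, $(\varphi\otimes\psi)(x,y)=\varphi(x)\psi(y)$, $\wedge$ is the minimum. Feller means mapping bounded continuous functions to bounded continuous functions. **Operator.**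 For a probability measure $\mu$ on $\mathsf{X}\times\mathsf{X}$ and $n\ge 1$ set $$F_{n-1,\mu,f}(x,y)=\frac{G_{n-1}(x)}{\mu(G_{n-1}\otimes 1)},\qquad F_{n-1,\mu,c}(x,y)=\frac{G_{n-1}(y)}{\mu(1\otimes G_{n-1})},$$ $$\overline F_{n-1,\mu,s}=\frac{F_{n-1,\mu,s}-F_{n-1,\mu,f}\wedge F_{n-1,\mu,c}}{\mu(F_{n-1,\mu,s}-F_{n-1,\mu,f}\wedge F_{n-1,\mu,c})},\quad s\in\{f,c\},$$ $\bar M_n(B)((x,y),(u,w))=\check M_n(B)(x,w)$, and $$\check\Phi_n^M(\mu)(B)=\mu\big(\{F_{n-1,\mu,f}\wedge F_{n-1,\mu,c}\}\check M_n(B)\big)+\big(1-\mu(F_{n-1,\mu,f}\wedge F_{n-1,\mu,c})\big)\,(\mu\otimes\mu)\big(\{\overline F_{n-1,\mu,f}\otimes\overline F_{n-1,\mu,c}\}\bar M_n(B)\big),$$ where the last summand is read as $0$ if $\mu(F_{n-1,\mu,f}\wedge F_{n-1,\mu,c})=1$. All normalizing constants $\mu(G_{n-1}\otimes1)$, $\mu(1\otimes G_{n-1})$ that occur are assumed (almost surely) strictly positive. **Limit.** $\check\eta_0^M=\check\eta_0$ and $\check\eta_n^M=\check\Phi_n^M(\check\eta_{n-1}^M)$ for $n\ge1$. **Particle system (maximally coupled resampling particle filter).** For $N\ge1$: $u_0^1,\dots,u_0^N$ are i.i.d. from $\check\eta_0$; for $p\ge 1$, conditionally on the particles up to time $p-1$,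 $u_p^1,\dots,u_p^N$ are i.i.d. from $\check\Phi_p^M(\check\eta_{p-1}^{N,M})$, where $\check\eta_p^{N,M}=\frac1N\sum_{i=1}^N\delta_{u_p^i}$. *)

theory Defs
  imports "HOL-Probability.Probability"
begin

text \<open>
  The state space is a type \<open>'a\<close> with its Borel sets. A metric space is separable
  iff it is second countable; the class \<open>second_countable_topology\<close> is the library's form of
  separability, and \<open>'a\<close> is in it iff \<open>'a \<times> 'a\<close> is. For such \<open>'a\<close> the Borel
  sigma-algebra of the product topology on \<open>'a \<times> 'a\<close> is the product sigma-algebra
  (lemma \<open>borel_prod\<close>), and a Markov kernel on a space is an element of
  \<open>borel \<rightarrow>\<^sub>M prob_algebra borel\<close>.
\<close>

definition bounded_continuous :: "('b::topological_space \<Rightarrow> real) \<Rightarrow> bool" where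
  "bounded_continuous \<phi> \<longleftrightarrow> continuous_on UNIV \<phi> \<and> bounded (range \<phi>)"

definition feller :: "('b::topological_space \<Rightarrow> 'b measure) \<Rightarrow> bool" where
  "feller K \<longleftrightarrow>
     (\<forall>\<phi>. bounded_continuous \<phi> \<longrightarrow> bounded_continuous (\<lambda>z. integral\<^sup>L (K z) \<phi>))"

text \<open>In the following, \<open>g\<close> stands for \<open>G\<^bsub>n-1\<^esub>\<close> and \<open>K\<close> for the coupled kernel at time \<open>n\<close>.\<close>

definition F_f :: "('a \<Rightarrow> real) \<Rightarrow> ('a \<times> 'a) measure \<Rightarrow> 'a \<times> 'a \<Rightarrow> real" where
  "F_f g \<mu> z = g (fst z) / (\<integral>v. g (fst v) \<partial>\<mu>)"

definition F_c :: "('a \<Rightarrow> real) \<Rightarrow> ('a \<times> 'a) measure \<Rightarrow> 'a \<times> 'a \<Rightarrow> real" where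
  "F_c g \<mu> z = g (snd z) / (\<integral>v. g (snd v) \<partial>\<mu>)"

definition F_min :: "('a \<Rightarrow> real) \<Rightarrow> ('a \<times> 'a) measure \<Rightarrow> 'a \<times> 'a \<Rightarrow> real" where
  "F_min g \<mu> z = min (F_f g \<mu> z) (F_c g \<mu> z)"

definition Fbar_f :: "('a \<Rightarrow> real) \<Rightarrow> ('a \<times> 'a) measure \<Rightarrow> 'a \<times> 'a \<Rightarrow> real" where
  "Fbar_f g \<mu> z = (F_f g \<mu> z - F_min g \<mu> z) / (\<integral>v. F_f g \<mu> v - F_min g \<mu> v \<partial>\<mu>)"

definition Fbar_c :: "('a \<Rightarrow> real) \<Rightarrow> ('a \<times> 'a) measure \<Rightarrow> 'a \<times> 'a \<Rightarrow> real" where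
  "Fbar_c g \<mu> z = (F_c g \<mu> z - F_min g \<mu> z) / (\<integral>v. F_c g \<mu> v - F_min g \<mu> v \<partial>\<mu>)"

definition Phi_set :: "('a::topological_space \<Rightarrow> real) \<Rightarrow> ('a \<times> 'a \<Rightarrow> ('a \<times> 'a) measure)
    \<Rightarrow> ('a \<times> 'a) measure \<Rightarrow> ('a \<times> 'a) set \<Rightarrow> ennreal" where
  "Phi_set g K \<mu> B =
     (\<integral>\<^sup>+z. ennreal (F_min g \<mu> z) * emeasure (K z) B \<partial>\<mu>) +
     (if (\<integral>z. F_min g \<mu> z \<partial>\<mu>) = 1 then 0
      else ennreal (1 - (\<integral>z. F_min g \<mu> z \<partial>\<mu>)) *
        (\<integral>\<^sup>+(z, z'). ennreal (Fbar_f g \<mu> z * Fbar_c g \<mu> z') * emeasure (K (fst z, snd z')) B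
          \<partial>(\<mu> \<Otimes>\<^sub>M \<mu>)))"

definition Phi :: "('a::topological_space \<Rightarrow> real) \<Rightarrow> ('a \<times> 'a \<Rightarrow> ('a \<times> 'a) measure)
    \<Rightarrow> ('a \<times> 'a) measure \<Rightarrow> ('a \<times> 'a) measure" where
  "Phi g K \<mu> = measure_of UNIV (sets borel) (Phi_set g K \<mu>)"

text \<open>\<open>Phi_set\<close> is countably additive, so \<open>measure_of\<close> does not collapse to the null measure.\<close>

lemma F_min_nonneg: "(\<And>x. 0 \<le> g x) \<Longrightarrow> 0 \<le> F_min g \<mu> z"
  by (auto simp: F_min_def F_f_def F_c_def intro!: divide_nonneg_nonneg integral_nonneg)

lemma F_min_measurable [measurable]:
  fixes g :: "'a::second_countable_topology \<Rightarrow> real"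
  assumes [measurable]: "g \<in> borel_measurable borel"
  shows "F_f g \<mu> \<in> borel_measurable borel" "F_c g \<mu> \<in> borel_measurable borel"
    "F_min g \<mu> \<in> borel_measurable borel"
    "Fbar_f g \<mu> \<in> borel_measurable borel" "Fbar_c g \<mu> \<in> borel_measurable borel"
proof -
  have [measurable]: "(\<lambda>z::'a \<times> 'a. g (fst z)) \<in> borel_measurable borel"
    "(\<lambda>z::'a \<times> 'a. g (snd z)) \<in> borel_measurable borel"
    unfolding borel_prod[symmetric] by measurable
  show [measurable]: "F_f g \<mu> \<in> borel_measurable borel" "F_c g \<mu> \<in> borel_measurable borel"
    unfolding F_f_def[abs_def] F_c_def[abs_def] by measurable
  then show [measurable]: "F_min g \<mu> \<in> borel_measurable borel"
    unfolding F_min_def[abs_def] by measurable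
  show "Fbar_f g \<mu> \<in> borel_measurable borel" "Fbar_c g \<mu> \<in> borel_measurable borel"
    unfolding Fbar_f_def[abs_def] Fbar_c_def[abs_def] by measurable
qed

lemma sets_Phi [simp]: "sets (Phi g K \<mu>) = sets borel"
  using sets.sets_measure_of_eq[of "borel :: ('a::topological_space \<times> 'a) measure"]
  by (simp add: Phi_def)

lemma emeasure_Phi:
  fixes g :: "'a::second_countable_topology \<Rightarrow> real"
  assumes g[measurable]: "g \<in> borel_measurable borel"
    and K: "K \<in> borel \<rightarrow>\<^sub>M prob_algebra borel"
    and \<mu>: "sets \<mu> = sets borel" and B: "B \<in> sets borel"
  shows "emeasure (Phi g K \<mu>) B = Phi_set g K \<mu> B"
proof (rule emeasure_measure_of[OF Phi_def])
  have sets_\<mu>\<mu>: "sets (\<mu> \<Otimes>\<^sub>M \<mu>) = sets (borel \<Otimes>\<^sub>M borel)"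
    using \<mu> by (intro sets_pair_measure_cong)
  have Ke: "(\<lambda>z. emeasure (K z) C) \<in> borel_measurable borel" if "C \<in> sets borel" for C
    using measurable_emeasure_kernel[OF measurable_prob_algebraD[OF K] that] .
  have mix: "(\<lambda>p :: ('a \<times> 'a) \<times> ('a \<times> 'a). (fst (fst p), snd (snd p)))
      \<in> (borel \<Otimes>\<^sub>M borel) \<rightarrow>\<^sub>M borel"
    unfolding borel_prod[symmetric] by measurable
  have Kee: "(\<lambda>p :: ('a \<times> 'a) \<times> ('a \<times> 'a). emeasure (K (fst (fst p), snd (snd p))) C) \<in> borel_measurable (borel \<Otimes>\<^sub>M borel)"
    if "C \<in> sets borel" for C
    using measurable_compose[OF mix Ke[OF that]] .
  have setsK: "sets (K z) = sets borel" for z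
    using measurable_space[OF K, of z] by (simp add: space_prob_algebra)
  show "countably_additive (sets (Phi g K \<mu>)) (Phi_set g K \<mu>)"
    unfolding sets_Phi
  proof (rule countably_additiveI)
    fix A :: "nat \<Rightarrow> ('a \<times> 'a) set"
    assume A: "range A \<subseteq> sets borel" "disjoint_family A"
    have sA: "(\<Sum>i. emeasure (K z) (A i)) = emeasure (K z) (\<Union>i. A i)" for z
      using A by (intro suminf_emeasure) (auto simp: setsK)
    have m: "(\<lambda>z. ennreal (F_min g \<mu> z)) \<in> borel_measurable \<mu>"
      "(\<lambda>p. ennreal (Fbar_f g \<mu> (fst p) * Fbar_c g \<mu> (snd p))) \<in> borel_measurable (\<mu> \<Otimes>\<^sub>M \<mu>)"
      unfolding measurable_cong_sets[OF \<mu> refl] measurable_cong_sets[OF sets_\<mu>\<mu> refl]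
      by measurable
    have mK: "(\<lambda>z. emeasure (K z) (A i)) \<in> borel_measurable \<mu>"
      "(\<lambda>p. emeasure (K (fst (fst p), snd (snd p))) (A i)) \<in> borel_measurable (\<mu> \<Otimes>\<^sub>M \<mu>)" for i
      unfolding measurable_cong_sets[OF \<mu> refl] measurable_cong_sets[OF sets_\<mu>\<mu> refl]
      using A Ke[of "A i"] Kee[of "A i"] by auto
    have 1: "(\<Sum>i. \<integral>\<^sup>+z. ennreal (F_min g \<mu> z) * emeasure (K z) (A i) \<partial>\<mu>) =
        (\<integral>\<^sup>+z. ennreal (F_min g \<mu> z) * emeasure (K z) (\<Union>i. A i) \<partial>\<mu>)"
      using m mK by (subst nn_integral_suminf[symmetric]) (auto simp: sA ennreal_suminf_cmult)
    have 2: "(\<Sum>i. \<integral>\<^sup>+p. ennreal (Fbar_f g \<mu> (fst p) * Fbar_c g \<mu> (snd p)) *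
            emeasure (K (fst (fst p), snd (snd p))) (A i) \<partial>(\<mu> \<Otimes>\<^sub>M \<mu>)) =
        (\<integral>\<^sup>+p. ennreal (Fbar_f g \<mu> (fst p) * Fbar_c g \<mu> (snd p)) *
            emeasure (K (fst (fst p), snd (snd p))) (\<Union>i. A i) \<partial>(\<mu> \<Otimes>\<^sub>M \<mu>))"
      using m mK by (subst nn_integral_suminf[symmetric]) (auto simp: sA ennreal_suminf_cmult)
    show "(\<Sum>i. Phi_set g K \<mu> (A i)) = Phi_set g K \<mu> (\<Union>i. A i)"
      unfolding Phi_set_def case_prod_beta
      by (subst suminf_add[symmetric]) (auto simp: 1 2 ennreal_suminf_cmult)
  qed
qed (use B in \<open>auto simp: positive_def Phi_set_def split_beta'\<close>)

definition empirical :: "nat \<Rightarrow> (nat \<Rightarrow> 'b::topological_space) \<Rightarrow> 'b measure" where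
  "empirical N v = distr (uniform_count_measure {..<N}) borel v"

lemma emeasure_empirical:
  assumes "B \<in> sets borel" "N \<ge> 1"
  shows "emeasure (empirical N v) B = (\<Sum>i<N. emeasure (return borel (v i)) B) / of_nat N"
proof -
  have "v \<in> uniform_count_measure {..<N} \<rightarrow>\<^sub>M borel"
    by (simp add: measurable_def space_uniform_count_measure sets_uniform_count_measure)
  then have "emeasure (empirical N v) B = ennreal (card {i\<in>{..<N}. v i \<in> B} / card {..<N})"
    using assms
    by (subst empirical_def, subst emeasure_distr)
      (auto simp: space_uniform_count_measure vimage_def Int_def conj_commute
        intro!: emeasure_uniform_count_measure[THEN trans])
  also have "\<dots> = of_nat (card {i\<in>{..<N}. v i \<in> B}) / of_nat N"
    using assms by (simp add: divide_ennreal[symmetric] ennreal_of_nat_eq_real_of_nat)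
  also have "of_nat (card {i\<in>{..<N}. v i \<in> B}) = (\<Sum>i<N. emeasure (return borel (v i)) B)"
    using assms by (simp add: indicator_def sum.If_cases Int_def)
  finally show ?thesis .
qed

primrec eta :: "(nat \<Rightarrow> 'a::topological_space \<Rightarrow> real) \<Rightarrow>
    (nat \<Rightarrow> 'a \<times> 'a \<Rightarrow> ('a \<times> 'a) measure) \<Rightarrow> ('a \<times> 'a) measure \<Rightarrow> nat \<Rightarrow> ('a \<times> 'a) measure" where
  "eta G M \<eta>0 0 = \<eta>0"
| "eta G M \<eta>0 (Suc n) = Phi (G n) (M (Suc n)) (eta G M \<eta>0 n)"

locale coupled_model =
  fixes G :: "nat \<Rightarrow> 'a::{metric_space, second_countable_topology} \<Rightarrow> real"
    and \<eta>0_f \<eta>0_c :: "'a measure"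
    and M_f M_c :: "nat \<Rightarrow> 'a \<Rightarrow> 'a measure"
    and \<eta>0 :: "('a \<times> 'a) measure"
    and M :: "nat \<Rightarrow> 'a \<times> 'a \<Rightarrow> ('a \<times> 'a) measure"
  assumes G_nonneg: "\<And>n x. 0 \<le> G n x"
    and G_bounded: "\<And>n. bounded (range (G n))"
    and G_measurable: "\<And>n. G n \<in> borel_measurable borel"
    and \<eta>0_f: "\<eta>0_f \<in> space (prob_algebra borel)"
    and \<eta>0_c: "\<eta>0_c \<in> space (prob_algebra borel)"
    and M_f: "\<And>n. 1 \<le> n \<Longrightarrow> M_f n \<in> borel \<rightarrow>\<^sub>M prob_algebra borel"
    and M_c: "\<And>n. 1 \<le> n \<Longrightarrow> M_c n \<in> borel \<rightarrow>\<^sub>M prob_algebra borel"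
    and \<eta>0: "\<eta>0 \<in> space (prob_algebra borel)"
    and \<eta>0_marginals: "distr \<eta>0 borel fst = \<eta>0_f" "distr \<eta>0 borel snd = \<eta>0_c"
    and M: "\<And>n. 1 \<le> n \<Longrightarrow> M n \<in> borel \<rightarrow>\<^sub>M prob_algebra borel"
    and M_marginals:
      "\<And>n x x'. 1 \<le> n \<Longrightarrow> distr (M n (x, x')) borel fst = M_f n x"
      "\<And>n x x'. 1 \<le> n \<Longrightarrow> distr (M n (x, x')) borel snd = M_c n x'"

definition history :: "'w measure \<Rightarrow> nat \<Rightarrow> (nat \<Rightarrow> nat \<Rightarrow> 'w \<Rightarrow> 'b::topological_space) \<Rightarrow> nat
    \<Rightarrow> 'w measure" where
  "history P N u p =
     sigma (space P) {u q i -` B \<inter> space P | q i B. q \<le> p \<and> i < N \<and> B \<in> sets borel}"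

text \<open>
  \<open>u p i\<close> is the particle with index \<open>i + 1\<close> at time \<open>p\<close>. The conditional law of the vector
  \<open>(u (Suc p) i)\<^bsub>i < N\<^esub>\<close> given the history is specified on measurable rectangles.
\<close>

locale particle_filter = prob_space P
  for P :: "'w measure" +
  fixes G :: "nat \<Rightarrow> 'a::topological_space \<Rightarrow> real"
    and \<eta>0 :: "('a \<times> 'a) measure"
    and M :: "nat \<Rightarrow> 'a \<times> 'a \<Rightarrow> ('a \<times> 'a) measure"
    and N :: nat
    and u :: "nat \<Rightarrow> nat \<Rightarrow> 'w \<Rightarrow> 'a \<times> 'a"
  assumes u_measurable: "\<And>p i. i < N \<Longrightarrow> u p i \<in> P \<rightarrow>\<^sub>M borel"
    and initial_indep: "indep_vars (\<lambda>_. borel) (u 0) {..<N}"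
    and initial_law: "\<And>i. i < N \<Longrightarrow> distr P borel (u 0 i) = \<eta>0"
    and transition: "\<And>p B. (\<And>i. i < N \<Longrightarrow> B i \<in> sets borel) \<Longrightarrow>
      AE \<omega> in P.
        real_cond_exp P (history P N u p)
          (indicator {\<omega>' \<in> space P. \<forall>i<N. u (Suc p) i \<omega>' \<in> B i}) \<omega> =
        (\<Prod>i<N. measure (Phi (G p) (M (Suc p)) (empirical N (\<lambda>j. u p j \<omega>))) (B i))"

text \<open>Convergence in probability to a constant; the \<open>X N\<close> may live on different spaces \<open>P N\<close>.\<close>

definition converges_in_prob :: "(nat \<Rightarrow> 'w measure) \<Rightarrow> (nat \<Rightarrow> 'w \<Rightarrow> real) \<Rightarrow> real \<Rightarrow> bool" where
  "converges_in_prob P X c \<longleftrightarrow>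
     (\<forall>\<epsilon>>0. (\<lambda>N. measure (P N) {\<omega> \<in> space (P N). \<bar>X N \<omega> - c\<bar> > \<epsilon>}) \<longlonglongrightarrow> 0)"

end

theory Submission
  imports Defs
begin

text \<open>
  The proof is an induction on time. Write \<open>\<mu> n\<close> for the empirical measure of the particles at time
  \<open>n\<close>, \<open>\<eta> n\<close> for the limit and \<open>\<Phi>\<close> for the operator that leads from time \<open>n\<close> to \<open>n + 1\<close>.
  For a bounded continuous function \<open>\<phi>\<close>, the error \<open>\<mu> (n + 1) \<phi> - \<eta> (n + 1) \<phi>\<close> splits into
  the sampling error \<open>\<mu> (n + 1) \<phi> - \<Phi> (\<mu> n) \<phi>\<close> and \<open>\<Phi> (\<mu> n) \<phi> - \<Phi> (\<eta> n) \<phi>\<close>.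

  Given the past, the particles at time \<open>n + 1\<close> are independent with law \<open>\<Phi> (\<mu> n)\<close>, so the second
  moment of the sampling error on a set is at most \<open>1 / N\<close> (\<open>transition_second_moment\<close>), and
  the sampling error vanishes in probability.

  The other part vanishes because \<open>\<Phi>\<close> is continuous for weak convergence (\<open>weakly_tendsto_Phi\<close>).
  The resampling weights depend on the measure only through integrals of the potential, hence converge
  uniformly. The residual part of \<open>\<Phi> \<mu>\<close> is an integral against \<open>\<mu> \<Otimes>\<^sub>M \<mu>\<close>, divided by the
  mass \<open>c\<close> that the two weights do not have in common. Two points need an argument. Weak convergence has to
  pass to \<open>\<mu> \<Otimes>\<^sub>M \<mu>\<close> (\<open>weakly_tendsto_pair\<close>), where a continuous function of two variables is
  approximated by sums of products of functions of one variable. And \<open>c\<close> may vanish at the limit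
  measure while it is positive along the sequence; but the numerator is of order \<open>c\<^sup>2\<close>, so that the residual
  part tends to its value \<open>0\<close> (\<open>excess_integral_bounded\<close>).

  The systems with different numbers \<open>N\<close> of particles live on unrelated probability spaces. Convergence in
  probability is therefore expressed as convergence along a filter on the pairs \<open>(N, \<omega>)\<close>, and
  weak convergence is treated along arbitrary filters: the continuity of \<open>\<Phi>\<close> then applies
  to random measures directly.
\<close>

section \<open>Convergence in probability as convergence along a filter\<close>

text \<open>
  A property of the pairs \<open>(N, \<omega>)\<close> holds eventually if it holds outside exceptional events
  whose probabilities tend to \<open>0\<close>. Convergence in probability then is
  \<^const>\<open>tendsto\<close> along this filter, even if the spaces \<open>P N\<close> differ, so that almost surely
  convergent subsequences make no sense; sums, quotients and uniform limits are covered by the general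
  theory of limits. The exceptional events are measured with \<^const>\<open>emeasure\<close>,
  which is subadditive for every \<open>P N\<close>, so that this is a filter for any family \<open>P\<close>.
\<close>

definition whp :: "(nat \<Rightarrow> 'w measure) \<Rightarrow> (nat \<times> 'w) filter" where
  "whp P = Abs_filter (\<lambda>Q. \<exists>A. (\<forall>N. A N \<in> sets (P N)) \<and>
     (\<forall>N. \<forall>\<omega>\<in>space (P N) - A N. Q (N, \<omega>)) \<and> (\<lambda>N. emeasure (P N) (A N)) \<longlonglongrightarrow> 0)"

lemma eventually_whp:
  "eventually Q (whp P) \<longleftrightarrow> (\<exists>A. (\<forall>N. A N \<in> sets (P N)) \<and>
     (\<forall>N. \<forall>\<omega>\<in>space (P N) - A N. Q (N, \<omega>)) \<and> (\<lambda>N. emeasure (P N) (A N)) \<longlonglongrightarrow> 0)"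
  unfolding whp_def
proof (rule eventually_Abs_filter, rule is_filter.intro, goal_cases)
  case 1
  show ?case by (rule exI[of _ "\<lambda>_. {}"]) simp
next
  case (2 Q R)
  then obtain A B where
    A: "\<And>N. A N \<in> sets (P N)" "\<And>N \<omega>. \<omega> \<in> space (P N) - A N \<Longrightarrow> Q (N, \<omega>)"
      "(\<lambda>N. emeasure (P N) (A N)) \<longlonglongrightarrow> 0" and
    B: "\<And>N. B N \<in> sets (P N)" "\<And>N \<omega>. \<omega> \<in> space (P N) - B N \<Longrightarrow> R (N, \<omega>)"
      "(\<lambda>N. emeasure (P N) (B N)) \<longlonglongrightarrow> 0"
    by blast
  have "(\<lambda>N. emeasure (P N) (A N \<union> B N)) \<longlonglongrightarrow> 0"
  proof (rule tendsto_sandwich[OF _ _ tendsto_const])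
    show "(\<lambda>N. emeasure (P N) (A N) + emeasure (P N) (B N)) \<longlonglongrightarrow> 0"
      using tendsto_add[OF A(3) B(3)] by simp
  qed (use A(1) B(1) in \<open>auto intro!: always_eventually emeasure_subadditive\<close>)
  with A B show ?case
    by (intro exI[of _ "\<lambda>N. A N \<union> B N"]) auto
next
  case (3 Q R)
  then show ?case by blast
qed

text \<open>The exceptional event for \<open>N = 0\<close> may be the whole space: one index does not affect a limit.\<close>

lemma eventually_whpI_AE:
  assumes "\<And>N. 1 \<le> N \<Longrightarrow> AE \<omega> in P N. Q (N, \<omega>)"
  shows "eventually Q (whp P)"
proof -
  have "\<exists>A. A \<in> sets (P N) \<and> (\<forall>\<omega>\<in>space (P N) - A. Q (N, \<omega>)) \<and> (1 \<le> N \<longrightarrow> emeasure (P N) A = 0)" for N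
  proof (cases "1 \<le> N")
    case True
    then obtain A where "{\<omega> \<in> space (P N). \<not> Q (N, \<omega>)} \<subseteq> A" "emeasure (P N) A = 0" "A \<in> sets (P N)"
      using AE_E[OF assms[OF True]] by metis
    then show ?thesis by blast
  qed (use sets.top in blast)
  then obtain A where A: "\<And>N. A N \<in> sets (P N)" "\<And>N \<omega>. \<omega> \<in> space (P N) - A N \<Longrightarrow> Q (N, \<omega>)"
    "\<And>N. 1 \<le> N \<Longrightarrow> emeasure (P N) (A N) = 0"
    by metis
  have "(\<lambda>N. emeasure (P N) (A N)) \<longlonglongrightarrow> 0"
    by (rule tendsto_eventually, rule eventually_mono[OF eventually_ge_at_top[of "1::nat"] A(3)])
  with A show ?thesis
    unfolding eventually_whp by blast
qed

lemma converges_in_prob_if_tendsto_whp: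
  fixes X :: "nat \<Rightarrow> 'w \<Rightarrow> real"
  assumes P: "\<And>N. 1 \<le> N \<Longrightarrow> prob_space (P N)"
    and X: "((\<lambda>(N, \<omega>). X N \<omega>) \<longlongrightarrow> c) (whp P)"
  shows "converges_in_prob P X c"
  unfolding converges_in_prob_def
proof (intro allI impI)
  fix \<epsilon> :: real assume "\<epsilon> > 0"
  with X have "\<forall>\<^sub>F (N, \<omega>) in whp P. dist (X N \<omega>) c < \<epsilon>"
    by (auto dest: tendstoD simp: case_prod_beta')
  then obtain A where A: "\<And>N. A N \<in> sets (P N)"
    "\<And>N \<omega>. \<omega> \<in> space (P N) - A N \<Longrightarrow> dist (X N \<omega>) c < \<epsilon>"
    "(\<lambda>N. emeasure (P N) (A N)) \<longlonglongrightarrow> 0"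
    unfolding eventually_whp by auto
  have bound: "measure (P N) {\<omega> \<in> space (P N). \<bar>X N \<omega> - c\<bar> > \<epsilon>} \<le> measure (P N) (A N)" if "1 \<le> N" for N
  proof -
    interpret prob_space "P N" by (rule P) fact
    show ?thesis
      using A(2)[of _ N] by (intro finite_measure_mono A(1)) (force simp: dist_real_def)
  qed
  have "(\<lambda>N. measure (P N) (A N)) \<longlonglongrightarrow> 0"
    using tendsto_enn2real[of _ 0] A(3) by (simp add: measure_def)
  then show "(\<lambda>N. measure (P N) {\<omega> \<in> space (P N). \<bar>X N \<omega> - c\<bar> > \<epsilon>}) \<longlonglongrightarrow> 0"
    by (intro tendsto_sandwich[OF _ eventually_mono[OF eventually_ge_at_top[of "1::nat"] bound] tendsto_const])
       auto
qed

text \<open>Chebyshev's inequality, in the form in which the law of large numbers enters.\<close>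

lemma tendsto_whp_0_if_second_moment:
  fixes Y :: "nat \<Rightarrow> 'w \<Rightarrow> real"
  assumes int: "\<And>N. 1 \<le> N \<Longrightarrow> integrable (P N) (\<lambda>\<omega>. (Y N \<omega>)\<^sup>2)"
    and bound: "\<And>N. 1 \<le> N \<Longrightarrow> (\<integral>\<omega>. (Y N \<omega>)\<^sup>2 \<partial>P N) \<le> b N"
    and b: "b \<longlonglongrightarrow> 0"
  shows "((\<lambda>(N, \<omega>). Y N \<omega>) \<longlongrightarrow> 0) (whp P)"
proof (rule tendstoI)
  fix e :: real assume e: "e > 0"
  define A where "A N = {\<omega> \<in> space (P N). (Y N \<omega>)\<^sup>2 \<ge> e\<^sup>2}" for N
  have A: "A N \<in> sets (P N)" if "1 \<le> N" for N
    unfolding A_def using borel_measurable_integrable[OF int[OF that]] by measurable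
  have lim: "(\<lambda>N. ennreal (1 / e\<^sup>2 * b N)) \<longlonglongrightarrow> 0"
    using tendsto_mult_right_zero[OF b] by (subst ennreal_0[symmetric]) (rule tendsto_ennrealI)
  have "emeasure (P N) (A N) \<le> ennreal (1 / e\<^sup>2 * b N)" if "1 \<le> N" for N
    using integral_Markov_inequality[OF int[OF that], of "e\<^sup>2"] e bound[OF that]
    by (force simp: A_def elim!: order_trans intro!: ennreal_leI mult_left_mono divide_right_mono)
  then have "(\<lambda>N. emeasure (P N) (A N)) \<longlonglongrightarrow> 0"
    by (intro tendsto_sandwich[OF _ eventually_mono[OF eventually_ge_at_top[of "1::nat"]] tendsto_const lim])
       auto
  moreover define B where "B N = (if 1 \<le> N then A N else space (P N))" for N
  have "eventually (\<lambda>N. emeasure (P N) (A N) = emeasure (P N) (B N)) sequentially"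
    using eventually_ge_at_top[of "1::nat"] by eventually_elim (simp add: B_def)
  ultimately have "(\<lambda>N. emeasure (P N) (B N)) \<longlonglongrightarrow> 0"
    by (rule Lim_transform_eventually)
  moreover have "B N \<in> sets (P N)" for N
    using A by (auto simp: B_def)
  moreover have "dist (Y N \<omega>) 0 < e" if "\<omega> \<in> space (P N) - B N" for N \<omega>
  proof -
    have "(Y N \<omega>)\<^sup>2 < e\<^sup>2"
      using that by (auto simp: B_def A_def split: if_splits)
    then show ?thesis
      using e abs_square_less_1 by (simp add: abs_le_square_iff[symmetric] not_le[symmetric])
  qed
  ultimately show "\<forall>\<^sub>F x in whp P. dist (case x of (N, \<omega>) \<Rightarrow> Y N \<omega>) 0 < e"
    unfolding eventually_whp by (auto intro!: exI[of _ B])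
qed

section \<open>The law of large numbers for one generation of particles\<close>

text \<open>
  \<open>q\<close> is to be thought of as the conditional expectation of each \<open>X i\<close>. The hypotheses
  make the variables \<open>X i - q\<close> pairwise orthogonal, hence only the \<open>N\<close> diagonal
  terms, each at most \<open>1\<close>, survive among the \<open>N\<^sup>2\<close> terms of the square. Independent particles
  (constant \<open>q\<close>) and conditionally independent ones are both instances.
\<close>

lemma (in prob_space) second_moment_of_average:
  fixes X :: "nat \<Rightarrow> 'a \<Rightarrow> real"
  assumes N: "1 \<le> N"
    and X: "\<And>i. i < N \<Longrightarrow> X i \<in> borel_measurable M" "\<And>i \<omega>. i < N \<Longrightarrow> \<bar>X i \<omega>\<bar> \<le> 1"
    and q: "q \<in> borel_measurable M" "AE \<omega> in M. \<bar>q \<omega>\<bar> \<le> 1"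
    and Xq: "\<And>i. i < N \<Longrightarrow> expectation (\<lambda>\<omega>. q \<omega> * X i \<omega>) = expectation (\<lambda>\<omega>. (q \<omega>)\<^sup>2)"
    and XX: "\<And>i j. i < N \<Longrightarrow> j < N \<Longrightarrow> i \<noteq> j \<Longrightarrow>
      expectation (\<lambda>\<omega>. X i \<omega> * X j \<omega>) = expectation (\<lambda>\<omega>. (q \<omega>)\<^sup>2)"
  shows "integrable M (\<lambda>\<omega>. ((\<Sum>i<N. X i \<omega>) / N - q \<omega>)\<^sup>2)"
    and "expectation (\<lambda>\<omega>. ((\<Sum>i<N. X i \<omega>) / N - q \<omega>)\<^sup>2) \<le> 1 / N"
proof -
  note [measurable] = q(1)
  have iqq: "integrable M (\<lambda>\<omega>. (q \<omega>)\<^sup>2)"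
    by (rule integrable_const_bound[of _ 1])
       (use q(2) in \<open>auto elim!: eventually_mono simp: abs_square_le_1\<close>)
  have iXq: "integrable M (\<lambda>\<omega>. q \<omega> * X i \<omega>)" if "i < N" for i
    by (rule integrable_const_bound[of _ 1])
       (use X that q(2) in \<open>auto elim!: eventually_mono simp: abs_mult intro: mult_le_one\<close>)
  have iXX: "integrable M (\<lambda>\<omega>. X i \<omega> * X j \<omega>)" if "i < N" "j < N" for i j
    by (rule integrable_const_bound[of _ 1])
       (use X that in \<open>auto simp: abs_mult intro!: AE_I2 mult_le_one\<close>)
  define V where "V = expectation (\<lambda>\<omega>. (q \<omega>)\<^sup>2)"
  define Z where "Z = (\<lambda>i j \<omega>. X i \<omega> * X j \<omega> - q \<omega> * X i \<omega> - q \<omega> * X j \<omega> + (q \<omega>)\<^sup>2)"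
  have iZ: "integrable M (Z i j)" if "i < N" "j < N" for i j
    unfolding Z_def using that
    by (intro Bochner_Integration.integrable_add Bochner_Integration.integrable_diff iXX iXq iqq)
  have EZ: "expectation (Z i j) \<le> (if i = j then 1 else 0)" if "i < N" "j < N" for i j
  proof -
    have "expectation (Z i j) = expectation (\<lambda>\<omega>. X i \<omega> * X j \<omega>) - V"
      unfolding Z_def V_def using iXX iXq iqq that by (simp add: Xq)
    moreover have "expectation (\<lambda>\<omega>. X i \<omega> * X i \<omega>) \<le> 1"
      by (rule integral_le_const[OF iXX[OF that(1) that(1)]])
         (use X(2)[OF that(1)] in \<open>simp add: abs_square_le_1 flip: power2_eq_square\<close>)
    moreover have "V \<ge> 0" unfolding V_def by simp
    moreover have "expectation (\<lambda>\<omega>. X i \<omega> * X j \<omega>) = V" if "i \<noteq> j"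
      using XX \<open>i < N\<close> \<open>j < N\<close> that unfolding V_def by blast
    ultimately show ?thesis by (cases "i = j") auto
  qed
  have N0: "real N \<noteq> 0" using N by simp
  have sq: "((\<Sum>i<N. X i \<omega>) / N - q \<omega>)\<^sup>2 = (\<Sum>i<N. \<Sum>j<N. Z i j \<omega>) / N\<^sup>2" for \<omega>
  proof -
    have "(\<Sum>i<N. X i \<omega>) / N - q \<omega> = (\<Sum>i<N. X i \<omega> - q \<omega>) / N"
      using N0 by (simp add: sum_subtractf field_simps)
    then have "((\<Sum>i<N. X i \<omega>) / N - q \<omega>)\<^sup>2 = (\<Sum>i<N. \<Sum>j<N. (X i \<omega> - q \<omega>) * (X j \<omega> - q \<omega>)) / N\<^sup>2"
      by (simp add: power_divide power2_eq_square[of "sum _ _"] sum_product)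
    also have "(\<Sum>i<N. \<Sum>j<N. (X i \<omega> - q \<omega>) * (X j \<omega> - q \<omega>)) = (\<Sum>i<N. \<Sum>j<N. Z i j \<omega>)"
      by (intro sum.cong refl) (simp add: Z_def algebra_simps power2_eq_square)
    finally show ?thesis .
  qed
  show "integrable M (\<lambda>\<omega>. ((\<Sum>i<N. X i \<omega>) / N - q \<omega>)\<^sup>2)"
    unfolding sq
    by (intro integrable_divide_zero Bochner_Integration.integrable_sum disjI2) (use iZ in auto)
  have "expectation (\<lambda>\<omega>. ((\<Sum>i<N. X i \<omega>) / N - q \<omega>)\<^sup>2) = (\<Sum>i<N. \<Sum>j<N. expectation (Z i j)) / N\<^sup>2"
    unfolding sq integral_divide_zero
    by (subst Bochner_Integration.integral_sum Bochner_Integration.integrable_sum; use iZ in simp)+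
  also have "\<dots> \<le> (\<Sum>i<N. \<Sum>j<N. if i = j then 1 else 0) / N\<^sup>2"
    using EZ by (intro divide_right_mono sum_mono) auto
  also have "\<dots> = 1 / N"
    using N0 by (simp add: power2_eq_square)
  finally show "expectation (\<lambda>\<omega>. ((\<Sum>i<N. X i \<omega>) / N - q \<omega>)\<^sup>2) \<le> 1 / N" .
qed

lemma prob_algebra_integrable_bounded:
  fixes f :: "'b::topological_space \<Rightarrow> real"
  assumes "\<mu> \<in> space (prob_algebra borel)" "f \<in> borel_measurable borel" "\<And>x. \<bar>f x\<bar> \<le> C"
  shows "integrable \<mu> f"
proof -
  interpret prob_space \<mu> using assms(1) by (simp add: space_prob_algebra)
  have "f \<in> borel_measurable \<mu>"
    using assms(1,2) by (auto simp: space_prob_algebra cong: measurable_cong_sets)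
  then show ?thesis
    by (intro integrable_const_bound[of _ C]) (use assms(3) in auto)
qed

lemma prob_algebra_integral_bounded:
  fixes f :: "'b::topological_space \<Rightarrow> real"
  assumes "\<mu> \<in> space (prob_algebra borel)" "f \<in> borel_measurable borel" "\<And>x. \<bar>f x\<bar> \<le> C"
  shows "\<bar>integral\<^sup>L \<mu> f\<bar> \<le> C"
proof -
  interpret prob_space \<mu> using assms(1) by (simp add: space_prob_algebra)
  have i: "integrable \<mu> f" by (rule prob_algebra_integrable_bounded[OF assms])
  have "integral\<^sup>L \<mu> f \<le> C" "- C \<le> integral\<^sup>L \<mu> f"
    using assms(3) by (auto intro!: integral_le_const integral_ge_const i simp: abs_le_iff minus_le_iff)
  then show ?thesis by simp
qed

text \<open>Round the values of \<open>f\<close> down to multiples of \<open>\<epsilon>\<close>.\<close>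

lemma bounded_measurable_uniform_approx:
  fixes f :: "'b \<Rightarrow> real"
  assumes f: "f \<in> borel_measurable M" and C: "\<And>x. \<bar>f x\<bar> \<le> C" and \<epsilon>: "\<epsilon> > 0"
  obtains K :: "int set" and c :: "int \<Rightarrow> real" and B :: "int \<Rightarrow> 'b set"
  where "finite K" "\<And>k. B k \<in> sets M"
    "\<And>x. x \<in> space M \<Longrightarrow> \<bar>f x - (\<Sum>k\<in>K. c k * indicator (B k) x)\<bar> \<le> \<epsilon>"
proof
  define K where "K = {- \<lceil>C / \<epsilon>\<rceil> - 1 .. \<lceil>C / \<epsilon>\<rceil> + 1}"
  define B where "B k = {x \<in> space M. \<lfloor>f x / \<epsilon>\<rfloor> = k}" for k
  show "finite K" by (simp add: K_def)
  show "B k \<in> sets M" for k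
    unfolding B_def using f by measurable
  fix x assume x: "x \<in> space M"
  have "\<bar>f x / \<epsilon>\<bar> \<le> C / \<epsilon>"
    using C[of x] \<epsilon> by (simp add: divide_right_mono)
  then have "\<lfloor>f x / \<epsilon>\<rfloor> \<in> K"
    unfolding K_def atLeastAtMost_iff by linarith
  then have "(\<Sum>k\<in>K. (\<epsilon> * of_int k) * indicator (B k) x) = \<epsilon> * of_int \<lfloor>f x / \<epsilon>\<rfloor>"
    using x by (subst sum.mono_neutral_right[of _ "{\<lfloor>f x / \<epsilon>\<rfloor>}"]) (auto simp: K_def B_def)
  moreover have "\<epsilon> * (f x / \<epsilon> - of_int \<lfloor>f x / \<epsilon>\<rfloor>) \<in> {0..\<epsilon>}"
    using \<epsilon> by (auto intro!: mult_nonneg_nonneg mult_left_le) linarith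
  then have "\<bar>\<epsilon> * (f x / \<epsilon> - of_int \<lfloor>f x / \<epsilon>\<rfloor>)\<bar> \<le> \<epsilon>" by simp
  ultimately show "\<bar>f x - (\<Sum>k\<in>K. (\<epsilon> * of_int k) * indicator (B k) x)\<bar> \<le> \<epsilon>"
    using \<epsilon> by (simp add: right_diff_distrib)
qed

text \<open>
  The particle dynamics is specified by probabilities of sets. Since a bounded measurable
  function is uniformly close to a finite combination of indicators, it suffices to compare the
  two families of measures on each set separately.
\<close>

lemma tendsto_integral_diff_if_tendsto_measure_diff:
  fixes f :: "'b::topological_space \<Rightarrow> real"
  assumes \<mu>: "\<forall>\<^sub>F i in F. \<mu> i \<in> space (prob_algebra borel)"
    and \<nu>: "\<forall>\<^sub>F i in F. \<nu> i \<in> space (prob_algebra borel)"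
    and lim: "\<And>B. B \<in> sets borel \<Longrightarrow> ((\<lambda>i. measure (\<mu> i) B - measure (\<nu> i) B) \<longlongrightarrow> 0) F"
    and f: "f \<in> borel_measurable borel" "\<And>x. \<bar>f x\<bar> \<le> C"
  shows "((\<lambda>i. integral\<^sup>L (\<mu> i) f - integral\<^sup>L (\<nu> i) f) \<longlongrightarrow> 0) F"
proof (rule tendstoI)
  fix e :: real assume e: "e > 0"
  then have "e / 4 > 0" by simp
  from bounded_measurable_uniform_approx[OF f this] obtain K and c :: "int \<Rightarrow> real" and B :: "int \<Rightarrow> 'b set"
    where K: "finite K" and B: "\<And>k. B k \<in> sets borel"
      and approx: "\<And>x. \<bar>f x - (\<Sum>k\<in>K. c k * indicator (B k) x)\<bar> \<le> e / 4"
    by (metis UNIV_I space_borel)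
  have near: "\<bar>integral\<^sup>L \<rho> f - (\<Sum>k\<in>K. c k * measure \<rho> (B k))\<bar> \<le> e / 4"
    if \<rho>: "\<rho> \<in> space (prob_algebra borel)" for \<rho> :: "'b measure"
  proof -
    interpret prob_space \<rho> using \<rho> by (simp add: space_prob_algebra)
    have B': "B k \<in> sets \<rho>" for k using B \<rho> by (simp add: space_prob_algebra)
    have i: "integrable \<rho> (\<lambda>x. c k * indicator (B k) x)" for k
      using B' by (intro integrable_mult_right integrable_real_indicator) (simp_all add: emeasure_eq_measure)
    have "(\<Sum>k\<in>K. c k * measure \<rho> (B k)) = integral\<^sup>L \<rho> (\<lambda>x. \<Sum>k\<in>K. c k * indicator (B k) x)"
      using B' i by (simp add: Bochner_Integration.integral_sum)
    moreover have "integrable \<rho> (\<lambda>x. \<Sum>k\<in>K. c k * indicator (B k) x)"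
      using i by simp
    ultimately have "integral\<^sup>L \<rho> f - (\<Sum>k\<in>K. c k * measure \<rho> (B k)) =
        integral\<^sup>L \<rho> (\<lambda>x. f x - (\<Sum>k\<in>K. c k * indicator (B k) x))"
      using prob_algebra_integrable_bounded[OF \<rho> f] by simp
    also have "\<bar>\<dots>\<bar> \<le> e / 4"
      using approx f(1) B by (intro prob_algebra_integral_bounded[OF \<rho>]) auto
    finally show ?thesis .
  qed
  have "((\<lambda>i. \<Sum>k\<in>K. c k * (measure (\<mu> i) (B k) - measure (\<nu> i) (B k))) \<longlongrightarrow> (\<Sum>k\<in>K. c k * 0)) F"
    by (intro tendsto_sum tendsto_mult tendsto_const lim B)
  then have "\<forall>\<^sub>F i in F. \<bar>\<Sum>k\<in>K. c k * (measure (\<mu> i) (B k) - measure (\<nu> i) (B k))\<bar> < e / 2"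
    using tendstoD[of _ "0::real" F "e / 2"] e by (simp add: dist_real_def)
  with \<mu> \<nu> show "\<forall>\<^sub>F i in F. dist (integral\<^sup>L (\<mu> i) f - integral\<^sup>L (\<nu> i) f) 0 < e"
  proof eventually_elim
    case (elim i)
    have "\<bar>(\<Sum>k\<in>K. c k * measure (\<mu> i) (B k)) - (\<Sum>k\<in>K. c k * measure (\<nu> i) (B k))\<bar> < e / 2"
      using elim(3) by (simp add: right_diff_distrib sum_subtractf)
    with near[OF elim(1)] near[OF elim(2)] show ?case
      unfolding dist_real_def by linarith
  qed
qed

lemma empirical_prob_algebra:
  assumes "1 \<le> N"
  shows "empirical N v \<in> space (prob_algebra borel)"
proof -
  have "prob_space (uniform_count_measure {..<N})"
    using assms by (intro prob_space_uniform_count_measure) (auto simp: lessThan_empty_iff)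
  then have "prob_space (empirical N v)"
    unfolding empirical_def
    by (intro prob_space.prob_space_distr)
       (simp_all add: measurable_def space_uniform_count_measure sets_uniform_count_measure)
  then show ?thesis
    by (simp add: space_prob_algebra empirical_def)
qed

lemma measure_empirical:
  assumes "1 \<le> N" "B \<in> sets borel"
  shows "measure (empirical N v) B = (\<Sum>i<N. indicator B (v i)) / N"
proof -
  have "emeasure (empirical N v) B = (\<Sum>i<N. ennreal (indicator B (v i))) / of_nat N"
    using assms by (simp add: emeasure_empirical ennreal_indicator)
  also have "\<dots> = ennreal ((\<Sum>i<N. indicator B (v i)) / N)"
    using assms by (simp add: divide_ennreal sum_nonneg ennreal_of_nat_eq_real_of_nat)
  finally show ?thesis
    by (simp add: measure_def sum_nonneg)
qed

context particle_filter
begin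

lemma subalgebra_history: "subalgebra P (history P N u p)"
proof -
  have "sigma_sets (space P) {u q i -` B \<inter> space P | q i B. q \<le> p \<and> i < N \<and> B \<in> sets borel} \<subseteq> sets P"
    by (rule sets.sigma_sets_subset) (auto intro: measurable_sets[OF u_measurable])
  then show ?thesis
    unfolding subalgebra_def history_def by (subst sets_measure_of) (auto simp: space_measure_of_conv)
qed

lemma initial_second_moment:
  assumes N: "1 \<le> N" and B: "B \<in> sets borel"
  shows "integrable P (\<lambda>\<omega>. (measure (empirical N (\<lambda>i. u 0 i \<omega>)) B - measure \<eta>0 B)\<^sup>2)"
    and "(\<integral>\<omega>. (measure (empirical N (\<lambda>i. u 0 i \<omega>)) B - measure \<eta>0 B)\<^sup>2 \<partial>P) \<le> 1 / N"
proof -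
  note [measurable] = u_measurable B
  have E: "expectation (\<lambda>\<omega>. indicator B (u 0 i \<omega>)) = measure \<eta>0 B" if i: "i < N" for i
  proof -
    have "measure \<eta>0 B = prob (u 0 i -` B \<inter> space P)"
      using measure_distr[OF u_measurable[OF i, of 0] B] initial_law[OF i] by simp
    also have "\<dots> = expectation (indicator (u 0 i -` B \<inter> space P))"
      by simp
    also have "\<dots> = expectation (\<lambda>\<omega>. indicator B (u 0 i \<omega>))"
      by (intro Bochner_Integration.integral_cong) (auto simp: indicator_def)
    finally show ?thesis ..
  qed
  have 1: "measure \<eta>0 B \<le> 1"
    using N initial_law[of 0] prob_space_distr[OF u_measurable[of 0 0]]
    by (intro prob_space.prob_le_1) auto
  have XX: "expectation (\<lambda>\<omega>. indicator B (u 0 i \<omega>) * indicator B (u 0 j \<omega>)) =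
      expectation (\<lambda>\<omega>. (measure \<eta>0 B)\<^sup>2)"
    if ij: "i < N" "j < N" "i \<noteq> j" for i j
  proof -
    have "indep_vars (\<lambda>_. borel) (\<lambda>k \<omega>. indicator B (u 0 k \<omega>) :: real) {i, j}"
      using ij by (intro indep_vars_compose2[OF indep_vars_subset[OF initial_indep]]) auto
    moreover have "integrable P (\<lambda>\<omega>. indicator B (u 0 k \<omega>) :: real)" if "k < N" for k
      using that by (intro integrable_const_bound[of _ 1]) auto
    ultimately have "expectation (\<lambda>\<omega>. \<Prod>k\<in>{i, j}. indicator B (u 0 k \<omega>)) =
        (\<Prod>k\<in>{i, j}. expectation (\<lambda>\<omega>. indicator B (u 0 k \<omega>) :: real))"
      using ij by (intro indep_vars_lebesgue_integral) auto
    with ij show ?thesis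
      by (simp add: E power2_eq_square prob_space)
  qed
  have Xq: "expectation (\<lambda>\<omega>. measure \<eta>0 B * indicator B (u 0 i \<omega>)) = expectation (\<lambda>\<omega>. (measure \<eta>0 B)\<^sup>2)"
    if "i < N" for i
    using E[OF that] by (simp add: prob_space power2_eq_square)
  note * = second_moment_of_average[of N "\<lambda>i \<omega>. indicator B (u 0 i \<omega>)" "\<lambda>_. measure \<eta>0 B",
      OF N _ _ _ _ Xq XX]
  show "integrable P (\<lambda>\<omega>. (measure (empirical N (\<lambda>i. u 0 i \<omega>)) B - measure \<eta>0 B)\<^sup>2)"
    "(\<integral>\<omega>. (measure (empirical N (\<lambda>i. u 0 i \<omega>)) B - measure \<eta>0 B)\<^sup>2 \<partial>P) \<le> 1 / N"
    unfolding measure_empirical[OF N B]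
    by (rule *; use 1 in simp)+
qed

text \<open>
  The conditional law of a generation depends on \<open>\<omega>\<close>, and \<open>measure (Q \<omega>) B\<close> is only almost
  surely equal to a random variable that is measurable with respect to the history. Taking that
  variable \<open>q\<close> to be the conditional expectation of \<open>indicator B\<close> at the first particle makes
  it possible to pull \<open>q\<close> out of conditional expectations.
\<close>

lemma transition_second_moment:
  fixes p :: nat
  defines "Q \<omega> \<equiv> Phi (G p) (M (Suc p)) (empirical N (\<lambda>i. u p i \<omega>))"
  assumes N: "1 \<le> N" and B: "B \<in> sets borel"
    and Q: "AE \<omega> in P. Q \<omega> \<in> space (prob_algebra borel)"
  obtains q where "AE \<omega> in P. q \<omega> = measure (Q \<omega>) B"
    "integrable P (\<lambda>\<omega>. (measure (empirical N (\<lambda>i. u (Suc p) i \<omega>)) B - q \<omega>)\<^sup>2)"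
    "(\<integral>\<omega>. (measure (empirical N (\<lambda>i. u (Suc p) i \<omega>)) B - q \<omega>)\<^sup>2 \<partial>P) \<le> 1 / N"
proof
  let ?F = "history P N u p"
  define X where "X i = (\<lambda>\<omega>. indicator B (u (Suc p) i \<omega>) :: real)" for i
  have X[measurable]: "X i \<in> borel_measurable P" if "i < N" for i
    using u_measurable[OF that] B unfolding X_def by measurable
  interpret finite_measure_subalgebra P ?F
    by unfold_locales (rule subalgebra_history)
  define q where "q = real_cond_exp P ?F (X 0)"
  have qF[measurable]: "q \<in> borel_measurable ?F" unfolding q_def by simp
  have q[measurable]: "q \<in> borel_measurable P" unfolding q_def by simp
  \<comment> \<open>Rectangles with \<open>B\<close> in the coordinates \<open>I\<close> and \<open>UNIV\<close> elsewhere; only \<open>I\<close> with one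
    or two elements are needed, since a second moment involves only pairs of particles.\<close>
  have rect: "AE \<omega> in P. real_cond_exp P ?F f \<omega> = (\<Prod>i\<in>I. measure (Q \<omega>) B)"
    if I: "I \<subseteq> {..<N}" and f: "f = (\<lambda>\<omega>. \<Prod>i\<in>I. X i \<omega>)" for I f
  proof -
    let ?D = "\<lambda>i. if i \<in> I then B else UNIV"
    let ?E = "{\<omega>' \<in> space P. \<forall>i<N. u (Suc p) i \<omega>' \<in> ?D i}"
    have fin: "finite I" using I finite_subset by blast
    have f_eq: "f \<omega> = indicator ?E \<omega>" if "\<omega> \<in> space P" for \<omega>
    proof (cases "\<forall>i\<in>I. u (Suc p) i \<omega> \<in> B")
      case False
      then show ?thesis using that fin I by (auto simp: f X_def indicator_def prod_zero_iff)
    qed (use that in \<open>auto simp: f X_def\<close>)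
    have fm: "f \<in> borel_measurable P"
      unfolding f using I X by (intro borel_measurable_prod) auto
    have "(indicator ?E :: _ \<Rightarrow> real) \<in> borel_measurable P"
      by (rule measurable_cong[THEN iffD1, OF f_eq fm])
    then have "AE \<omega> in P. real_cond_exp P ?F f \<omega> = real_cond_exp P ?F (indicator ?E) \<omega>"
      using fm f_eq by (intro real_cond_exp_cong AE_I2)
    moreover have "AE \<omega> in P. real_cond_exp P ?F (indicator ?E) \<omega> = (\<Prod>i<N. measure (Q \<omega>) (?D i))"
      unfolding Q_def using B by (intro transition) auto
    ultimately show ?thesis
      using Q
    proof eventually_elim
      case (elim \<omega>)
      interpret Q: prob_space "Q \<omega>" using elim(3) by (simp add: space_prob_algebra)
      have "space (Q \<omega>) = UNIV" using elim(3) by (simp add: space_prob_algebra sets_eq_imp_space_eq[of _ borel])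
      then have "measure (Q \<omega>) UNIV = 1" using Q.prob_space by simp
      then have "(\<Prod>i<N. measure (Q \<omega>) (?D i)) = (\<Prod>i\<in>I. measure (Q \<omega>) B)"
        using I by (intro prod.mono_neutral_cong_right) auto
      with elim show ?case by simp
    qed
  qed
  have qi: "AE \<omega> in P. real_cond_exp P ?F (X i) \<omega> = measure (Q \<omega>) B" if "i < N" for i
    using rect[of "{i}" "X i"] that by simp
  show qQ: "AE \<omega> in P. q \<omega> = measure (Q \<omega>) B"
    unfolding q_def using qi[of 0] N by simp
  have q1: "AE \<omega> in P. \<bar>q \<omega>\<bar> \<le> 1"
    using qQ Q by eventually_elim (auto simp: space_prob_algebra prob_space.prob_le_1)
  have Xq: "expectation (\<lambda>\<omega>. q \<omega> * X i \<omega>) = expectation (\<lambda>\<omega>. (q \<omega>)\<^sup>2)" if i: "i < N" for i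
  proof -
    have "integrable P (\<lambda>\<omega>. q \<omega> * X i \<omega>)"
      using X[OF i] q1 by (intro integrable_const_bound[of _ 1])
        (auto simp: X_def abs_mult intro!: mult_le_one elim!: eventually_mono)
    then have "expectation (\<lambda>\<omega>. q \<omega> * X i \<omega>) = expectation (\<lambda>\<omega>. q \<omega> * real_cond_exp P ?F (X i) \<omega>)"
      using X[OF i] by (intro real_cond_exp_intg(2)[symmetric]) auto
    also have "\<dots> = expectation (\<lambda>\<omega>. (q \<omega>)\<^sup>2)"
    proof (rule integral_cong_AE)
      show "AE \<omega> in P. q \<omega> * real_cond_exp P ?F (X i) \<omega> = (q \<omega>)\<^sup>2"
        using qi[OF i] qQ by eventually_elim (simp add: power2_eq_square)
    qed measurable
    finally show ?thesis .
  qed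
  have XX: "expectation (\<lambda>\<omega>. X i \<omega> * X j \<omega>) = expectation (\<lambda>\<omega>. (q \<omega>)\<^sup>2)"
    if ij: "i < N" "j < N" "i \<noteq> j" for i j
  proof -
    let ?f = "\<lambda>\<omega>. X i \<omega> * X j \<omega>"
    have "integrable P ?f"
      using X ij by (intro integrable_const_bound[of _ 1])
        (auto simp: X_def abs_mult intro!: mult_le_one)
    then have "expectation ?f = expectation (real_cond_exp P ?F ?f)"
      by (rule real_cond_exp_int(2)[symmetric])
    also have "\<dots> = expectation (\<lambda>\<omega>. (q \<omega>)\<^sup>2)"
    proof (rule integral_cong_AE)
      have "AE \<omega> in P. real_cond_exp P ?F ?f \<omega> = (\<Prod>k\<in>{i, j}. measure (Q \<omega>) B)"
        using ij by (intro rect) auto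
      then show "AE \<omega> in P. real_cond_exp P ?F ?f \<omega> = (q \<omega>)\<^sup>2"
        using qQ by eventually_elim (use ij in \<open>simp add: power2_eq_square\<close>)
    qed measurable
    finally show ?thesis .
  qed
  note * = second_moment_of_average[of N X q, OF N X _ q q1 Xq XX]
  have avg: "measure (empirical N (\<lambda>i. u (Suc p) i \<omega>)) B = (\<Sum>i<N. X i \<omega>) / N" for \<omega>
    unfolding measure_empirical[OF N B] X_def ..
  show "integrable P (\<lambda>\<omega>. (measure (empirical N (\<lambda>i. u (Suc p) i \<omega>)) B - q \<omega>)\<^sup>2)"
    "(\<integral>\<omega>. (measure (empirical N (\<lambda>i. u (Suc p) i \<omega>)) B - q \<omega>)\<^sup>2 \<partial>P) \<le> 1 / N"
    unfolding avg by (rule *; simp add: X_def)+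
qed

end

section \<open>Weak convergence of product measures\<close>

lemma bounded_continuousI:
  fixes f :: "'b::topological_space \<Rightarrow> real"
  assumes "continuous_on UNIV f" "\<And>x. \<bar>f x\<bar> \<le> C"
  shows "bounded_continuous f"
  using assms by (auto simp: bounded_continuous_def bounded_iff)

lemma bounded_continuousE:
  fixes f :: "'b::topological_space \<Rightarrow> real"
  assumes "bounded_continuous f"
  obtains C where "continuous_on UNIV f" "f \<in> borel_measurable borel" "\<And>x. \<bar>f x\<bar> \<le> C" "0 \<le> C"
proof -
  from assms obtain C where C: "continuous_on UNIV f" "\<And>x. \<bar>f x\<bar> \<le> C"
    by (auto simp: bounded_continuous_def bounded_iff)
  moreover have "0 \<le> C" using C(2)[of undefined] by simp
  ultimately show ?thesis
    using that borel_measurable_continuous_onI[of f] by blast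
qed

lemma bounded_continuous_const: "bounded_continuous (\<lambda>_. c)"
  by (rule bounded_continuousI[of _ "\<bar>c\<bar>"]) auto

lemma bounded_continuous_add:
  fixes f g :: "'b::topological_space \<Rightarrow> real"
  assumes "bounded_continuous f" "bounded_continuous g"
  shows "bounded_continuous (\<lambda>x. f x + g x)"
proof -
  from assms obtain C D where "continuous_on UNIV f" "\<And>x. \<bar>f x\<bar> \<le> C"
    "continuous_on UNIV g" "\<And>x. \<bar>g x\<bar> \<le> D"
    by (metis bounded_continuousE)
  then show ?thesis
    by (intro bounded_continuousI[of _ "C + D"] continuous_intros)
       (auto intro: order_trans[OF abs_triangle_ineq] add_mono)
qed

lemma bounded_continuous_mult:
  fixes f g :: "'b::topological_space \<Rightarrow> real"
  assumes "bounded_continuous f" "bounded_continuous g"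
  shows "bounded_continuous (\<lambda>x. f x * g x)"
proof -
  from assms obtain C D where "continuous_on UNIV f" "\<And>x. \<bar>f x\<bar> \<le> C"
    "continuous_on UNIV g" "\<And>x. \<bar>g x\<bar> \<le> D" "0 \<le> C"
    by (metis bounded_continuousE)
  then show ?thesis
    by (intro bounded_continuousI[of _ "C * D"] continuous_intros)
       (auto simp: abs_mult intro: mult_mono)
qed

lemma bounded_continuous_compose:
  fixes f :: "'b::topological_space \<Rightarrow> real"
  assumes "bounded_continuous f" "continuous_on UNIV h"
  shows "bounded_continuous (\<lambda>x. f (h x))"
  using assms by (auto intro: continuous_on_compose2 bounded_subset simp: bounded_continuous_def)

text \<open>
  The convergence is along an arbitrary filter, so that \<open>\<mu>\<close> may be a family of random measures
  converging in probability.
\<close>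

definition weakly_tendsto ::
    "('i \<Rightarrow> 'b::topological_space measure) \<Rightarrow> 'b measure \<Rightarrow> 'i filter \<Rightarrow> bool" where
  "weakly_tendsto \<mu> \<nu> F \<longleftrightarrow>
     (\<forall>\<phi>. bounded_continuous \<phi> \<longrightarrow> ((\<lambda>i. integral\<^sup>L (\<mu> i) \<phi>) \<longlongrightarrow> integral\<^sup>L \<nu> \<phi>) F)"

lemma prob_algebra_pair:
  fixes \<mu> :: "'b::second_countable_topology measure"
  assumes "\<mu> \<in> space (prob_algebra borel)"
  shows "\<mu> \<Otimes>\<^sub>M \<mu> \<in> space (prob_algebra borel)"
proof -
  interpret prob_space \<mu> using assms by (simp add: space_prob_algebra)
  interpret pair_prob_space \<mu> \<mu> ..
  have "sets (\<mu> \<Otimes>\<^sub>M \<mu>) = sets (borel \<Otimes>\<^sub>M borel)"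
    using assms by (intro sets_pair_measure_cong) (auto simp: space_prob_algebra)
  then show ?thesis
    unfolding borel_prod by (simp add: space_prob_algebra P.prob_space_axioms)
qed

lemma tensor_measurable:
  fixes f g :: "'b::second_countable_topology \<Rightarrow> real"
  assumes [measurable]: "f \<in> borel_measurable borel" "g \<in> borel_measurable borel"
  shows "(\<lambda>z. f (fst z) * g (snd z)) \<in> borel_measurable borel"
  unfolding borel_prod[symmetric] by measurable

lemma tensor_bounded:
  fixes f g :: "'b \<Rightarrow> real"
  assumes f: "\<And>x. \<bar>f x\<bar> \<le> C" and g: "\<And>x. \<bar>g x\<bar> \<le> D"
  shows "\<bar>f (fst z) * g (snd z)\<bar> \<le> C * D"
proof -
  have "0 \<le> C" using f[of "fst z"] by linarith
  with f g show ?thesis by (simp add: abs_mult mult_mono)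
qed

lemma integral_tensor:
  fixes f g :: "'b::second_countable_topology \<Rightarrow> real"
  assumes \<mu>: "\<mu> \<in> space (prob_algebra borel)"
    and f: "f \<in> borel_measurable borel" "\<And>x. \<bar>f x\<bar> \<le> C"
    and g: "g \<in> borel_measurable borel" "\<And>x. \<bar>g x\<bar> \<le> D"
  shows "(\<integral>z. f (fst z) * g (snd z) \<partial>(\<mu> \<Otimes>\<^sub>M \<mu>)) = integral\<^sup>L \<mu> f * integral\<^sup>L \<mu> g"
proof -
  interpret prob_space \<mu> using \<mu> by (simp add: space_prob_algebra)
  interpret pair_prob_space \<mu> \<mu> ..
  have "integrable (\<mu> \<Otimes>\<^sub>M \<mu>) (\<lambda>z. f (fst z) * g (snd z))"
    by (intro prob_algebra_integrable_bounded[of _ _ "C * D"] prob_algebra_pair \<mu>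
        tensor_measurable tensor_bounded f g)
  from integral_fst'[OF this] show ?thesis by simp
qed

text \<open>
  The algebra spanned by products of functions of one variable: for these functions the
  integral against \<open>\<mu> \<Otimes>\<^sub>M \<mu>\<close> is a polynomial in integrals against \<open>\<mu>\<close>.
\<close>

inductive_set tensors :: "('b::topological_space \<times> 'b \<Rightarrow> real) set" where
  tensors_prod: "bounded_continuous f \<Longrightarrow> bounded_continuous g \<Longrightarrow> (\<lambda>z. f (fst z) * g (snd z)) \<in> tensors"
| tensors_add: "h \<in> tensors \<Longrightarrow> k \<in> tensors \<Longrightarrow> (\<lambda>z. h z + k z) \<in> tensors"

lemma tensors_const: "(\<lambda>_. c) \<in> tensors"
  using tensors_prod[OF bounded_continuous_const[of c] bounded_continuous_const[of 1]] by simp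

lemma tensors_mult:
  assumes "h \<in> tensors" "k \<in> tensors"
  shows "(\<lambda>z. h z * k z) \<in> tensors"
  using assms(1)
proof induction
  case fg: (tensors_prod f g)
  from assms(2) show ?case
  proof induction
    case (tensors_prod f' g')
    with fg have "(\<lambda>z. (f (fst z) * f' (fst z)) * (g (snd z) * g' (snd z))) \<in> tensors"
      by (intro tensors.tensors_prod[of "\<lambda>x. f x * f' x" "\<lambda>x. g x * g' x"] bounded_continuous_mult)
    then show ?case by (simp add: mult_ac)
  next
    case (tensors_add h k)
    from tensors.tensors_add[OF tensors_add.IH] show ?case by (simp add: distrib_left)
  qed
next
  case (tensors_add h1 h2)
  from tensors.tensors_add[OF tensors_add.IH] show ?case by (simp add: distrib_right)
qed

lemma tensors_sum: "(\<And>i. i \<in> I \<Longrightarrow> h i \<in> tensors) \<Longrightarrow> (\<lambda>z. \<Sum>i\<in>I. h i z) \<in> tensors"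
  by (induction I rule: infinite_finite_induct) (auto intro: tensors_const tensors_add)

lemma tensors_bounded_continuous: "h \<in> tensors \<Longrightarrow> bounded_continuous h"
proof (induction rule: tensors.induct)
  case (tensors_prod f g)
  show ?case
    by (intro bounded_continuous_mult bounded_continuous_compose[OF tensors_prod(1)]
        bounded_continuous_compose[OF tensors_prod(2)] continuous_intros)
qed (rule bounded_continuous_add)

lemma tendsto_integral_tensors:
  fixes \<mu> :: "'i \<Rightarrow> 'b::second_countable_topology measure"
  assumes \<mu>: "\<forall>\<^sub>F i in F. \<mu> i \<in> space (prob_algebra borel)"
    and \<nu>: "\<nu> \<in> space (prob_algebra borel)"
    and lim: "weakly_tendsto \<mu> \<nu> F"
    and h: "h \<in> tensors"
  shows "((\<lambda>i. integral\<^sup>L (\<mu> i \<Otimes>\<^sub>M \<mu> i) h) \<longlongrightarrow> integral\<^sup>L (\<nu> \<Otimes>\<^sub>M \<nu>) h) F"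
  using h
proof induction
  case (tensors_prod f g)
  from tensors_prod obtain C D where f: "f \<in> borel_measurable borel" "\<And>x. \<bar>f x\<bar> \<le> C"
    and g: "g \<in> borel_measurable borel" "\<And>x. \<bar>g x\<bar> \<le> D"
    by (metis bounded_continuousE)
  have "((\<lambda>i. integral\<^sup>L (\<mu> i) f * integral\<^sup>L (\<mu> i) g) \<longlongrightarrow> integral\<^sup>L \<nu> f * integral\<^sup>L \<nu> g) F"
    using lim tensors_prod by (intro tendsto_mult) (auto simp: weakly_tendsto_def)
  moreover have "\<forall>\<^sub>F i in F. integral\<^sup>L (\<mu> i) f * integral\<^sup>L (\<mu> i) g =
      (\<integral>z. f (fst z) * g (snd z) \<partial>(\<mu> i \<Otimes>\<^sub>M \<mu> i))"
    using \<mu> by eventually_elim (simp add: integral_tensor[OF _ f g])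
  ultimately show ?case
    using integral_tensor[OF \<nu> f g] by (simp add: tendsto_cong)
next
  case (tensors_add h k)
  have int: "integrable (\<rho> \<Otimes>\<^sub>M \<rho>) j" if "\<rho> \<in> space (prob_algebra borel)" "j \<in> tensors"
    for \<rho> :: "'b measure" and j
    using tensors_bounded_continuous[OF that(2)]
    by (metis bounded_continuousE prob_algebra_integrable_bounded prob_algebra_pair that(1))
  have "\<forall>\<^sub>F i in F. integral\<^sup>L (\<mu> i \<Otimes>\<^sub>M \<mu> i) h + integral\<^sup>L (\<mu> i \<Otimes>\<^sub>M \<mu> i) k =
      (\<integral>z. h z + k z \<partial>(\<mu> i \<Otimes>\<^sub>M \<mu> i))"
    using \<mu> by eventually_elim (simp add: int tensors_add)
  with tendsto_add[OF tensors_add.IH] show ?case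
    using \<nu> by (simp add: int tensors_add tendsto_cong)
qed

text \<open>For \<open>r > 0\<close>, a piecewise linear function of the distance to \<open>x\<close>: it is \<open>1\<close> up to
  radius \<open>r\<close> and \<open>0\<close> from radius \<open>2 * r\<close> on.\<close>

definition cutoff :: "real \<Rightarrow> 'b::metric_space \<Rightarrow> 'b \<Rightarrow> real" where
  "cutoff r x y = max 0 (min 1 (2 - dist y x / r))"

lemma cutoff_range: "0 \<le> cutoff r x y" "cutoff r x y \<le> 1"
  by (auto simp: cutoff_def)

lemma cutoff_eq_1: "0 < r \<Longrightarrow> dist y x < r \<Longrightarrow> cutoff r x y = 1"
  by (auto simp: cutoff_def min_def field_simps)

lemma cutoff_eq_0: "0 < r \<Longrightarrow> 2 * r \<le> dist y x \<Longrightarrow> cutoff r x y = 0"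
  by (auto simp: cutoff_def field_simps)

lemma bounded_continuous_cutoff:
  assumes "r > 0"
  shows "bounded_continuous (cutoff r x)"
  by (rule bounded_continuousI[of _ 1])
     (use assms in \<open>auto simp: cutoff_def intro!: continuous_intros\<close>)

text \<open>
  A Stone--Weierstrass approximation up to small \<open>\<theta>\<close>-mass, by a partition of unity.
  On some product of balls around each point, \<open>H\<close> differs by at most \<open>\<epsilon> / 2\<close> from its
  value at that point. Countably many
  smaller products of balls cover the space (Lindelof), and their cutoffs \<open>w 0, w 1, \<dots>\<close> are products
  of functions of one variable. The weights \<open>(\<Prod>j<k. 1 - w j) * w k\<close> stay tensors and sum up
  to \<open>1 - rest n\<close>; replacing \<open>H\<close> by its value at the \<open>k\<close>-th centre costs at most \<open>\<epsilon> / 2\<close> where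
  the \<open>k\<close>-th weight lives. Every point is covered eventually, so \<open>rest n\<close> vanishes pointwise in
  the limit and its integral tends to \<open>0\<close>. The error bound \<open>R\<close> is itself a tensor, which allows
  it to be controlled under measures other than \<open>\<theta>\<close>.
\<close>

lemma tensor_approximation:
  fixes H :: "'b::{metric_space, second_countable_topology} \<times> 'b \<Rightarrow> real"
  assumes H: "bounded_continuous H"
    and \<theta>: "\<theta> \<in> space (prob_algebra borel)" and \<epsilon>: "0 < \<epsilon>"
  obtains A R where "A \<in> tensors" "R \<in> tensors" "\<And>z. \<bar>H z - A z\<bar> \<le> R z" "integral\<^sup>L \<theta> R < \<epsilon>"
proof -
  from H obtain C where H_cont: "continuous_on UNIV H" and C: "\<And>z. \<bar>H z\<bar> \<le> C" "0 \<le> C"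
    by (metis bounded_continuousE)
  have "\<exists>r>0. \<forall>z. dist (fst z) (fst p) < 2 * r \<longrightarrow> dist (snd z) (snd p) < 2 * r \<longrightarrow>
      \<bar>H z - H p\<bar> \<le> \<epsilon> / 2" for p
  proof -
    obtain d where d: "d > 0" "\<And>z. dist z p < d \<Longrightarrow> dist (H z) (H p) < \<epsilon> / 2"
      using H_cont \<epsilon> unfolding continuous_on_iff by (metis UNIV_I half_gt_zero)
    have "\<bar>H z - H p\<bar> \<le> \<epsilon> / 2"
      if "dist (fst z) (fst p) < 2 * (d / 4)" "dist (snd z) (snd p) < 2 * (d / 4)" for z
    proof -
      have "dist z p \<le> dist (fst z) (fst p) + dist (snd z) (snd p)"
        unfolding dist_prod_def by (intro sqrt_sum_squares_le_sum) auto
      with that have "dist z p < d" by simp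
      from d(2)[OF this] show ?thesis by (simp add: dist_real_def)
    qed
    with d(1) show ?thesis by (intro exI[of _ "d / 4"]) auto
  qed
  then obtain r where r: "\<And>p. r p > 0" and osc: "\<And>p z. dist (fst z) (fst p) < 2 * r p \<Longrightarrow>
      dist (snd z) (snd p) < 2 * r p \<Longrightarrow> \<bar>H z - H p\<bar> \<le> \<epsilon> / 2"
    by metis
  define U where "U p = ball (fst p) (r p) \<times> ball (snd p) (r p)" for p
  obtain \<D> where \<D>: "\<D> \<subseteq> range U" "countable \<D>" "\<Union>\<D> = \<Union>(range U)"
    by (rule Lindelof[of "range U"]) (auto simp: U_def open_Times)
  then obtain D where D: "countable D" "\<D> = U ` D"
    by (metis countable_subset_image)
  have "p \<in> U p" for p using r by (cases p) (auto simp: U_def)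
  then have cover: "\<exists>p\<in>D. z \<in> U p" for z
    using \<D>(3) D(2) by blast
  then have "D \<noteq> {}" by blast
  define c where "c = from_nat_into D"
  have c: "range c = D"
    using range_from_nat_into[OF \<open>D \<noteq> {}\<close> D(1)] by (simp add: c_def)
  define w where "w k z = cutoff (r (c k)) (fst (c k)) (fst z) * cutoff (r (c k)) (snd (c k)) (snd z)" for k z
  define rest where "rest n z = (\<Prod>k<n. 1 - w k z)" for n z
  define A where "A n z = (\<Sum>k<n. H (c k) * (rest k z * w k z))" for n z
  have w_tensor: "w k \<in> tensors" for k
    unfolding w_def by (intro tensors_prod bounded_continuous_cutoff r)
  have rest_tensor: "rest n \<in> tensors" for n
  proof (induction n)
    case (Suc n)
    have "(\<lambda>z. rest n z * (1 + (-1) * w n z)) \<in> tensors"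
      by (intro tensors_mult tensors_add tensors_const w_tensor Suc)
    then show ?case by (simp add: rest_def mult_ac)
  qed (simp add: rest_def tensors_const)
  have A_tensor: "A n \<in> tensors" for n
    unfolding A_def by (intro tensors_sum tensors_mult tensors_const w_tensor rest_tensor)
  have w_range: "0 \<le> w k z" "w k z \<le> 1" for k z
    by (auto simp: w_def cutoff_range intro!: mult_le_one)
  have rest_range: "0 \<le> rest n z" "rest n z \<le> 1" for n z
    by (auto simp: rest_def w_range intro!: prod_nonneg prod_le_1)
  have close: "\<bar>H z * (1 - rest n z) - A n z\<bar> \<le> \<epsilon> / 2 * (1 - rest n z)" for n z
  proof (induction n)
    case (Suc n)
    have "\<bar>H z - H (c n)\<bar> * w n z \<le> \<epsilon> / 2 * w n z"
    proof (cases "w n z = 0")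
      case False
      then have "dist (fst z) (fst (c n)) < 2 * r (c n)" "dist (snd z) (snd (c n)) < 2 * r (c n)"
        using cutoff_eq_0[OF r[of "c n"], of "fst z" "fst (c n)"]
          cutoff_eq_0[OF r[of "c n"], of "snd z" "snd (c n)"]
        by (auto simp: w_def not_le[symmetric])
      from osc[OF this] show ?thesis using w_range by (intro mult_right_mono)
    qed simp
    then have "\<bar>(H z - H (c n)) * (rest n z * w n z)\<bar> \<le> \<epsilon> / 2 * (rest n z * w n z)"
      using mult_left_mono[of "\<bar>H z - H (c n)\<bar> * w n z" "\<epsilon> / 2 * w n z" "rest n z"]
        rest_range(1)[of n z] w_range(1)[of n z]
      by (simp add: abs_mult mult_ac)
    moreover have "H z * (1 - rest (Suc n) z) - A (Suc n) z =
        (H z * (1 - rest n z) - A n z) + (H z - H (c n)) * (rest n z * w n z)"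
      "\<epsilon> / 2 * (1 - rest (Suc n) z) = \<epsilon> / 2 * (1 - rest n z) + \<epsilon> / 2 * (rest n z * w n z)"
      by (simp_all add: rest_def A_def algebra_simps)
    ultimately show ?case using Suc by linarith
  qed (simp add: rest_def A_def)
  define R where "R n z = \<epsilon> / 2 + C * rest n z" for n z
  have "\<bar>H z - A n z\<bar> \<le> R n z" for n z
  proof -
    have "\<bar>H z * rest n z\<bar> \<le> C * rest n z"
      using C rest_range[of n z] by (simp add: abs_mult mult_right_mono)
    moreover have "\<epsilon> / 2 * (1 - rest n z) \<le> \<epsilon> / 2"
      using rest_range[of n z] \<epsilon> by simp
    moreover have "H z - A n z = (H z * (1 - rest n z) - A n z) + H z * rest n z"
      by (simp add: algebra_simps)
    ultimately show ?thesis
      using close[of z n] unfolding R_def by linarith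
  qed
  moreover have "R n \<in> tensors" for n
    unfolding R_def by (intro tensors_add tensors_mult tensors_const rest_tensor)
  moreover have "\<exists>n. integral\<^sup>L \<theta> (R n) < \<epsilon>"
  proof -
    interpret prob_space \<theta> using \<theta> by (simp add: space_prob_algebra)
    have rest_meas: "rest n \<in> borel_measurable borel" for n
      using bounded_continuousE[OF tensors_bounded_continuous[OF rest_tensor]] by metis
    have rest_int: "integrable \<theta> (rest n)" for n
      using rest_range by (intro prob_algebra_integrable_bounded[OF \<theta> rest_meas, of _ 1]) simp
    have "(\<lambda>n. rest n z) \<longlonglongrightarrow> 0" for z
    proof -
      obtain k where "z \<in> U (c k)" using cover[of z] c by blast
      then have "w k z = 1"
        by (auto simp: U_def w_def cutoff_eq_1 dist_commute r)
      then have "rest n z = 0" if "Suc k \<le> n" for n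
        using that by (auto simp: rest_def intro!: bexI[of _ k])
      then show ?thesis
        by (intro tendsto_eventually eventually_mono[OF eventually_ge_at_top[of "Suc k"]])
    qed
    then have "(\<lambda>n. integral\<^sup>L \<theta> (rest n)) \<longlonglongrightarrow> (\<integral>z. 0 \<partial>\<theta>)"
      using rest_range rest_int
      by (intro integral_dominated_convergence[where w = "\<lambda>_. 1"]) auto
    then have "(\<lambda>n. \<epsilon> / 2 + C * integral\<^sup>L \<theta> (rest n)) \<longlonglongrightarrow> \<epsilon> / 2 + C * 0"
      by (intro tendsto_intros) simp
    then have "\<forall>\<^sub>F n in sequentially. \<epsilon> / 2 + C * integral\<^sup>L \<theta> (rest n) < \<epsilon>"
      using \<epsilon> by (auto dest: order_tendstoD(2)[of _ _ _ \<epsilon>])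
    then obtain n where "\<epsilon> / 2 + C * integral\<^sup>L \<theta> (rest n) < \<epsilon>"
      by (auto dest: eventually_happens)
    moreover have "integral\<^sup>L \<theta> (R n) = \<epsilon> / 2 + C * integral\<^sup>L \<theta> (rest n)"
      unfolding R_def using rest_int by (simp add: prob_space)
    ultimately show ?thesis by (intro exI[of _ n]) linarith
  qed
  ultimately show ?thesis using that A_tensor by blast
qed

text \<open>
  The error of the tensor approximation, being bounded by a tensor with small integral under the
  limit, is small under \<open>\<mu> i \<Otimes>\<^sub>M \<mu> i\<close> as well.
\<close>

lemma weakly_tendsto_pair:
  fixes \<mu> :: "'i \<Rightarrow> 'b::{metric_space, second_countable_topology} measure"
  assumes \<mu>: "\<forall>\<^sub>F i in F. \<mu> i \<in> space (prob_algebra borel)"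
    and \<nu>: "\<nu> \<in> space (prob_algebra borel)"
    and lim: "weakly_tendsto \<mu> \<nu> F"
  shows "weakly_tendsto (\<lambda>i. \<mu> i \<Otimes>\<^sub>M \<mu> i) (\<nu> \<Otimes>\<^sub>M \<nu>) F"
  unfolding weakly_tendsto_def
proof (intro allI impI tendstoI)
  fix H :: "'b \<times> 'b \<Rightarrow> real" and e :: real
  assume H: "bounded_continuous H" and e: "e > 0"
  obtain A R where A: "A \<in> tensors" and R: "R \<in> tensors" and le: "\<And>z. \<bar>H z - A z\<bar> \<le> R z"
    and small: "integral\<^sup>L (\<nu> \<Otimes>\<^sub>M \<nu>) R < e / 4"
    using tensor_approximation[OF H prob_algebra_pair[OF \<nu>], of "e / 4"] e by auto
  have near: "\<bar>integral\<^sup>L (\<rho> \<Otimes>\<^sub>M \<rho>) H - integral\<^sup>L (\<rho> \<Otimes>\<^sub>M \<rho>) A\<bar> \<le> integral\<^sup>L (\<rho> \<Otimes>\<^sub>M \<rho>) R"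
    if \<rho>: "\<rho> \<in> space (prob_algebra borel)" for \<rho> :: "'b measure"
  proof -
    have int: "integrable (\<rho> \<Otimes>\<^sub>M \<rho>) j" if "bounded_continuous j" for j
      using that by (metis bounded_continuousE prob_algebra_integrable_bounded prob_algebra_pair \<rho>)
    note ints = int[OF H] tensors_bounded_continuous[OF A, THEN int]
      tensors_bounded_continuous[OF R, THEN int]
    have "integral\<^sup>L (\<rho> \<Otimes>\<^sub>M \<rho>) H - integral\<^sup>L (\<rho> \<Otimes>\<^sub>M \<rho>) A = (\<integral>z. H z - A z \<partial>(\<rho> \<Otimes>\<^sub>M \<rho>))"
      using ints by simp
    also have "\<bar>\<dots>\<bar> \<le> (\<integral>z. \<bar>H z - A z\<bar> \<partial>(\<rho> \<Otimes>\<^sub>M \<rho>))"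
      by (rule integral_abs_bound)
    also have "\<dots> \<le> integral\<^sup>L (\<rho> \<Otimes>\<^sub>M \<rho>) R"
      using ints le by (intro integral_mono) auto
    finally show ?thesis .
  qed
  have lims: "\<forall>\<^sub>F i in F. dist (integral\<^sup>L (\<mu> i \<Otimes>\<^sub>M \<mu> i) j) (integral\<^sup>L (\<nu> \<Otimes>\<^sub>M \<nu>) j) < e / 4"
    if "j \<in> tensors" for j
    using tendsto_integral_tensors[OF \<mu> \<nu> lim that] e by (intro tendstoD) auto
  from \<mu> lims[OF A] lims[OF R]
  show "\<forall>\<^sub>F i in F. dist (integral\<^sup>L (\<mu> i \<Otimes>\<^sub>M \<mu> i) H) (integral\<^sup>L (\<nu> \<Otimes>\<^sub>M \<nu>) H) < e"
  proof eventually_elim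
    case (elim i)
    with near[OF elim(1)] near[OF \<nu>] small show ?case
      unfolding dist_real_def by linarith
  qed
qed

section \<open>Integrals against the law of a resampled particle\<close>

locale coupled_resampling =
  fixes g :: "'a::{metric_space, second_countable_topology} \<Rightarrow> real"
    and C :: real
    and K :: "'a \<times> 'a \<Rightarrow> ('a \<times> 'a) measure"
    and \<mu> :: "('a \<times> 'a) measure"
  assumes g_nonneg: "0 \<le> g x" and g_le: "g x \<le> C"
    and g_measurable[measurable]: "g \<in> borel_measurable borel"
    and K: "K \<in> borel \<rightarrow>\<^sub>M prob_algebra borel"
    and \<mu>: "\<mu> \<in> space (prob_algebra borel)"
    and f_pos: "(\<integral>z. g (fst z) \<partial>\<mu>) > 0"
    and c_pos: "(\<integral>z. g (snd z) \<partial>\<mu>) > 0"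

definition excess_f :: "('a \<Rightarrow> real) \<Rightarrow> ('a \<times> 'a) measure \<Rightarrow> 'a \<times> 'a \<Rightarrow> real" where
  "excess_f g \<mu> z = F_f g \<mu> z - F_min g \<mu> z"

definition excess_c :: "('a \<Rightarrow> real) \<Rightarrow> ('a \<times> 'a) measure \<Rightarrow> 'a \<times> 'a \<Rightarrow> real" where
  "excess_c g \<mu> z = F_c g \<mu> z - F_min g \<mu> z"

definition cross :: "('a \<times> 'a) \<times> ('a \<times> 'a) \<Rightarrow> 'a \<times> 'a" where
  "cross p = (fst (fst p), snd (snd p))"

text \<open>
  The unnormalized second summand of the operator: with the residual weights not divided by their
  common mass \<open>c = 1 - (\<integral>z. F_min g \<mu> z \<partial>\<mu>)\<close>, the prefactor \<open>c\<close> and the two normalizations \<open>1 / c\<close>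
  combine to the single factor \<open>1 / c\<close>. The convention \<open>x / 0 = 0\<close> then agrees with reading
  the summand as \<open>0\<close> in the case \<open>c = 0\<close>.
\<close>

definition excess_integral :: "('a \<Rightarrow> real) \<Rightarrow> ('a \<times> 'a \<Rightarrow> ('a \<times> 'a) measure)
    \<Rightarrow> ('a \<times> 'a) measure \<Rightarrow> ('a \<times> 'a \<Rightarrow> real) \<Rightarrow> real" where
  "excess_integral g K \<mu> \<phi> =
     (\<integral>p. excess_f g \<mu> (fst p) * excess_c g \<mu> (snd p) * integral\<^sup>L (K (cross p)) \<phi> \<partial>(\<mu> \<Otimes>\<^sub>M \<mu>))"

definition Phi_integral :: "('a \<Rightarrow> real) \<Rightarrow> ('a \<times> 'a \<Rightarrow> ('a \<times> 'a) measure)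
    \<Rightarrow> ('a \<times> 'a) measure \<Rightarrow> ('a \<times> 'a \<Rightarrow> real) \<Rightarrow> real" where
  "Phi_integral g K \<mu> \<phi> = (\<integral>z. F_min g \<mu> z * integral\<^sup>L (K z) \<phi> \<partial>\<mu>) +
     excess_integral g K \<mu> \<phi> / (1 - (\<integral>z. F_min g \<mu> z \<partial>\<mu>))"

lemma continuous_on_cross: "continuous_on UNIV cross"
  unfolding cross_def by (intro continuous_intros)

lemma cross_measurable[measurable]:
  "(cross :: ('a::second_countable_topology \<times> 'a) \<times> ('a \<times> 'a) \<Rightarrow> _) \<in> borel_measurable borel"
  by (intro borel_measurable_continuous_onI continuous_on_cross)

lemma excess_measurable[measurable]:
  fixes g :: "'a::second_countable_topology \<Rightarrow> real"
  assumes [measurable]: "g \<in> borel_measurable borel"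
  shows "excess_f g \<mu> \<in> borel_measurable borel" "excess_c g \<mu> \<in> borel_measurable borel"
  unfolding excess_f_def excess_c_def by measurable

lemma prob_kernel_prob_algebra:
  assumes "K \<in> borel \<rightarrow>\<^sub>M prob_algebra borel"
  shows "K z \<in> space (prob_algebra borel)"
  using measurable_space[OF assms, of z] by simp

lemma nn_kernel_measurable:
  assumes "K \<in> borel \<rightarrow>\<^sub>M prob_algebra borel" "f \<in> borel_measurable borel"
  shows "(\<lambda>z. \<integral>\<^sup>+y. f y \<partial>K z) \<in> borel_measurable borel"
  using measurable_compose[OF measurable_prob_algebraD[OF assms(1)] nn_integral_measurable_subprob_algebra[OF assms(2)]]
  by simp

lemma kernel_integral_measurable:
  fixes f :: "_ \<Rightarrow> real"
  assumes "K \<in> borel \<rightarrow>\<^sub>M prob_algebra borel" "f \<in> borel_measurable borel"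
  shows "(\<lambda>z. integral\<^sup>L (K z) f) \<in> borel_measurable borel"
  using measurable_compose[OF measurable_prob_algebraD[OF assms(1)] integral_measurable_subprob_algebra[OF assms(2)]]
  by simp

context coupled_resampling
begin

abbreviation "common_mass \<equiv> \<integral>z. F_min g \<mu> z \<partial>\<mu>"

lemma sets_\<mu>: "sets \<mu> = sets borel"
  using \<mu> by (simp add: space_prob_algebra)

lemma sets_\<mu>\<mu>: "sets (\<mu> \<Otimes>\<^sub>M \<mu>) = sets borel"
  using prob_algebra_pair[OF \<mu>] by (simp add: space_prob_algebra)

lemma \<mu>_measurable: "measurable \<mu> N = measurable borel N" "measurable (\<mu> \<Otimes>\<^sub>M \<mu>) N = measurable borel N"
  by (intro measurable_cong_sets refl sets_\<mu> sets_\<mu>\<mu>)+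

definition weight_bound :: real where
  "weight_bound = max (C / (\<integral>z. g (fst z) \<partial>\<mu>)) (C / (\<integral>z. g (snd z) \<partial>\<mu>))"

lemma weights_range:
  "0 \<le> F_f g \<mu> z" "F_f g \<mu> z \<le> weight_bound" "0 \<le> F_c g \<mu> z" "F_c g \<mu> z \<le> weight_bound"
  "0 \<le> F_min g \<mu> z" "F_min g \<mu> z \<le> weight_bound"
  "0 \<le> excess_f g \<mu> z" "excess_f g \<mu> z \<le> weight_bound"
  "0 \<le> excess_c g \<mu> z" "excess_c g \<mu> z \<le> weight_bound"
proof -
  show 1: "0 \<le> F_f g \<mu> z" "0 \<le> F_c g \<mu> z"
    using f_pos c_pos g_nonneg by (simp_all add: F_f_def F_c_def)
  show 2: "F_f g \<mu> z \<le> weight_bound" "F_c g \<mu> z \<le> weight_bound"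
    unfolding F_f_def F_c_def weight_bound_def using f_pos c_pos g_le
    by (simp_all add: le_max_iff_disj divide_right_mono)
  show "0 \<le> F_min g \<mu> z" "F_min g \<mu> z \<le> weight_bound"
    "0 \<le> excess_f g \<mu> z" "excess_f g \<mu> z \<le> weight_bound"
    "0 \<le> excess_c g \<mu> z" "excess_c g \<mu> z \<le> weight_bound"
    using 1 2 by (auto simp: F_min_def excess_f_def excess_c_def)
qed

lemma weights_abs:
  "\<bar>F_f g \<mu> z\<bar> \<le> weight_bound" "\<bar>F_c g \<mu> z\<bar> \<le> weight_bound" "\<bar>F_min g \<mu> z\<bar> \<le> weight_bound"
  "\<bar>excess_f g \<mu> z\<bar> \<le> weight_bound" "\<bar>excess_c g \<mu> z\<bar> \<le> weight_bound"
  using weights_range[of z] by simp_all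

lemma weight_bound_nonneg: "0 \<le> weight_bound"
  using weights_range(1,2)[of undefined] by linarith

lemma weights_integrable:
  "integrable \<mu> (F_f g \<mu>)" "integrable \<mu> (F_c g \<mu>)" "integrable \<mu> (F_min g \<mu>)"
  by (intro prob_algebra_integrable_bounded[OF \<mu>, of _ weight_bound] weights_abs F_min_measurable g_measurable)+

lemma integral_excess: "integral\<^sup>L \<mu> (excess_f g \<mu>) = 1 - common_mass" "integral\<^sup>L \<mu> (excess_c g \<mu>) = 1 - common_mass"
proof -
  have "integral\<^sup>L \<mu> (F_f g \<mu>) = 1" "integral\<^sup>L \<mu> (F_c g \<mu>) = 1"
    unfolding F_f_def F_c_def using f_pos c_pos by simp_all
  then show "integral\<^sup>L \<mu> (excess_f g \<mu>) = 1 - common_mass" "integral\<^sup>L \<mu> (excess_c g \<mu>) = 1 - common_mass"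
    unfolding excess_f_def excess_c_def using weights_integrable by simp_all
qed

lemma common_mass_le_1: "common_mass \<le> 1"
  using Bochner_Integration.integral_nonneg[of \<mu> "excess_f g \<mu>"] weights_range integral_excess(1) by simp

lemma kernel_integral_bounded:
  fixes \<phi> :: "'a \<times> 'a \<Rightarrow> real"
  assumes "\<phi> \<in> borel_measurable borel" "\<And>z. \<bar>\<phi> z\<bar> \<le> B"
  shows "\<bar>integral\<^sup>L (K z) \<phi>\<bar> \<le> B"
  by (intro prob_algebra_integral_bounded prob_kernel_prob_algebra K assms)

lemma integrable_common:
  assumes "\<phi> \<in> borel_measurable borel" "\<And>z. \<bar>\<phi> z\<bar> \<le> B"
  shows "integrable \<mu> (\<lambda>z. F_min g \<mu> z * integral\<^sup>L (K z) \<phi>)"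
proof (rule prob_algebra_integrable_bounded[OF \<mu>])
  show "(\<lambda>z. F_min g \<mu> z * integral\<^sup>L (K z) \<phi>) \<in> borel_measurable borel"
    by (intro borel_measurable_times F_min_measurable g_measurable kernel_integral_measurable K assms)
  show "\<bar>F_min g \<mu> z * integral\<^sup>L (K z) \<phi>\<bar> \<le> weight_bound * B" for z
    unfolding abs_mult
    by (intro mult_mono weights_abs kernel_integral_bounded assms abs_ge_zero weight_bound_nonneg)
qed

lemma excess_tensor:
  "(\<lambda>p. excess_f g \<mu> (fst p) * excess_c g \<mu> (snd p)) \<in> borel_measurable borel"
  "\<bar>excess_f g \<mu> (fst p) * excess_c g \<mu> (snd p)\<bar> \<le> weight_bound * weight_bound"
  by (intro tensor_measurable excess_measurable g_measurable)
     (intro tensor_bounded weights_abs)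

lemma integral_excess_tensor:
  "(\<integral>p. excess_f g \<mu> (fst p) * excess_c g \<mu> (snd p) \<partial>(\<mu> \<Otimes>\<^sub>M \<mu>)) = (1 - common_mass) * (1 - common_mass)"
  using integral_tensor[OF \<mu> excess_measurable(1)[OF g_measurable] weights_abs(4)
      excess_measurable(2)[OF g_measurable] weights_abs(5)]
  by (simp add: integral_excess)

lemma integrable_excess:
  assumes "\<phi> \<in> borel_measurable borel" "\<And>z. \<bar>\<phi> z\<bar> \<le> B"
  shows "integrable (\<mu> \<Otimes>\<^sub>M \<mu>)
    (\<lambda>p. excess_f g \<mu> (fst p) * excess_c g \<mu> (snd p) * integral\<^sup>L (K (cross p)) \<phi>)"
proof (rule prob_algebra_integrable_bounded[OF prob_algebra_pair[OF \<mu>]])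
  show "(\<lambda>p. excess_f g \<mu> (fst p) * excess_c g \<mu> (snd p) * integral\<^sup>L (K (cross p)) \<phi>)
      \<in> borel_measurable borel"
    by (intro borel_measurable_times excess_tensor(1) assms
        measurable_compose[OF cross_measurable kernel_integral_measurable[OF K]])
  show "\<bar>excess_f g \<mu> (fst p) * excess_c g \<mu> (snd p) * integral\<^sup>L (K (cross p)) \<phi>\<bar> \<le>
      weight_bound * weight_bound * B" for p
    unfolding abs_mult[of _ "integral\<^sup>L _ _"]
    by (intro mult_mono excess_tensor(2) kernel_integral_bounded assms abs_ge_zero
        mult_nonneg_nonneg weight_bound_nonneg)
qed

text \<open>
  The residual weights \<open>excess_f\<close> and \<open>excess_c\<close> both have integral \<open>1 - common_mass\<close>, so the
  double integral is at most \<open>B\<close> times its square. This bound is what makes the operator continuous at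
  measures where the residual summand is degenerate.
\<close>

lemma excess_integral_bounded:
  assumes \<phi>: "\<phi> \<in> borel_measurable borel" "\<And>z. \<bar>\<phi> z\<bar> \<le> B"
  shows "\<bar>excess_integral g K \<mu> \<phi> / (1 - common_mass)\<bar> \<le> B * (1 - common_mass)"
proof -
  have "\<bar>excess_integral g K \<mu> \<phi>\<bar> \<le>
      (\<integral>p. \<bar>excess_f g \<mu> (fst p) * excess_c g \<mu> (snd p) * integral\<^sup>L (K (cross p)) \<phi>\<bar> \<partial>(\<mu> \<Otimes>\<^sub>M \<mu>))"
    unfolding excess_integral_def by (rule integral_abs_bound)
  also have "\<dots> \<le> (\<integral>p. excess_f g \<mu> (fst p) * excess_c g \<mu> (snd p) * B \<partial>(\<mu> \<Otimes>\<^sub>M \<mu>))"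
  proof (rule integral_mono)
    show "integrable (\<mu> \<Otimes>\<^sub>M \<mu>) (\<lambda>p. \<bar>excess_f g \<mu> (fst p) * excess_c g \<mu> (snd p) * integral\<^sup>L (K (cross p)) \<phi>\<bar>)"
      by (rule integrable_abs[OF integrable_excess[OF \<phi>]])
    show "integrable (\<mu> \<Otimes>\<^sub>M \<mu>) (\<lambda>p. excess_f g \<mu> (fst p) * excess_c g \<mu> (snd p) * B)"
      by (intro integrable_mult_left prob_algebra_integrable_bounded[OF prob_algebra_pair[OF \<mu>] excess_tensor])
  qed (auto simp: abs_mult weights_range intro!: mult_left_mono kernel_integral_bounded \<phi>)
  also have "\<dots> = (1 - common_mass) * (1 - common_mass) * B"
    by (simp add: integral_excess_tensor)
  finally show ?thesis
    using common_mass_le_1 by (cases "common_mass = 1") (simp_all add: field_simps)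
qed

text \<open>
  By definition the formula holds for indicators; the standard extension to measurable functions
  applies because each term is additive and continuous from below in \<open>f\<close>.
\<close>

lemma nn_integral_Phi:
  assumes "f \<in> borel_measurable borel"
  shows "(\<integral>\<^sup>+z. f z \<partial>Phi g K \<mu>) =
    (\<integral>\<^sup>+z. ennreal (F_min g \<mu> z) * (\<integral>\<^sup>+y. f y \<partial>K z) \<partial>\<mu>) +
    (if common_mass = 1 then 0 else ennreal (1 - common_mass)) *
      (\<integral>\<^sup>+p. ennreal (Fbar_f g \<mu> (fst p) * Fbar_c g \<mu> (snd p)) * (\<integral>\<^sup>+y. f y \<partial>K (cross p)) \<partial>(\<mu> \<Otimes>\<^sub>M \<mu>))"
  using assms
proof (induction rule: borel_measurable_induct)
  have sets_K: "sets (K z) = sets borel" for z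
    using prob_kernel_prob_algebra[OF K, of z] by (simp add: space_prob_algebra)
  have K_measurable: "measurable (K z) N = measurable borel N" for z and N :: "'z measure"
    by (rule measurable_cong_sets[OF sets_K refl])
  have Phi_measurable: "measurable (Phi g K \<mu>) N = measurable borel N" for N :: "'z measure"
    by (rule measurable_cong_sets) simp_all
  have Fb: "(\<lambda>p. ennreal (Fbar_f g \<mu> (fst p) * Fbar_c g \<mu> (snd p))) \<in> borel_measurable borel"
    by (intro measurable_compose[OF tensor_measurable measurable_ennreal] F_min_measurable g_measurable)
  have Fm: "(\<lambda>z. ennreal (F_min g \<mu> z)) \<in> borel_measurable borel" by measurable
  note Kf = nn_kernel_measurable[OF K]
  note Kc = measurable_compose[OF cross_measurable Kf]
  {
    case (cong f f')
    then have "f = f'" by auto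
    with cong show ?case by simp
  next
    case (set A)
    then show ?case
      using emeasure_Phi[OF g_measurable K sets_\<mu> set] sets_K
      by (simp add: Phi_set_def cross_def case_prod_beta')
  next
    case (mult f c)
    have "(\<integral>\<^sup>+z. ennreal (F_min g \<mu> z) * (c * (\<integral>\<^sup>+y. f y \<partial>K z)) \<partial>\<mu>) =
        c * (\<integral>\<^sup>+z. ennreal (F_min g \<mu> z) * (\<integral>\<^sup>+y. f y \<partial>K z) \<partial>\<mu>)"
      using mult.hyps(2) Fm Kf
      by (subst nn_integral_cmult[symmetric]) (auto simp: \<mu>_measurable mult_ac)
    moreover have "(\<integral>\<^sup>+p. ennreal (Fbar_f g \<mu> (fst p) * Fbar_c g \<mu> (snd p)) * (c * (\<integral>\<^sup>+y. f y \<partial>K (cross p))) \<partial>(\<mu> \<Otimes>\<^sub>M \<mu>)) =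
        c * (\<integral>\<^sup>+p. ennreal (Fbar_f g \<mu> (fst p) * Fbar_c g \<mu> (snd p)) * (\<integral>\<^sup>+y. f y \<partial>K (cross p)) \<partial>(\<mu> \<Otimes>\<^sub>M \<mu>))"
      using mult.hyps(2) Fb Kc
      by (subst nn_integral_cmult[symmetric]) (auto simp: \<mu>_measurable mult_ac)
    ultimately show ?case
      using mult by (simp add: nn_integral_cmult K_measurable Phi_measurable distrib_left mult_ac)
  next
    case (add f h)
    then show ?case
      using Fm Fb Kf Kc
      by (simp add: nn_integral_add K_measurable Phi_measurable \<mu>_measurable distrib_left add_ac)
  next
    case (seq U)
    have mono: "(\<integral>\<^sup>+y. U i y \<partial>K z) \<le> (\<integral>\<^sup>+y. U j y \<partial>K z)" if "i \<le> j" for i j z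
      using incseqD[OF seq.hyps(3) that] by (intro nn_integral_mono) (rule le_funD)
    have SUP_nn: "(\<integral>\<^sup>+y. (SUP i. U i) y \<partial>\<rho>) = (SUP i. \<integral>\<^sup>+y. U i y \<partial>\<rho>)"
      if "sets \<rho> = sets borel" for \<rho>
      unfolding SUP_apply using seq.hyps(1,3) that
      by (intro nn_integral_monotone_convergence_SUP) (auto cong: measurable_cong_sets)
    have 1: "(\<integral>\<^sup>+z. ennreal (F_min g \<mu> z) * (SUP i. \<integral>\<^sup>+y. U i y \<partial>K z) \<partial>\<mu>) =
        (SUP i. \<integral>\<^sup>+z. ennreal (F_min g \<mu> z) * (\<integral>\<^sup>+y. U i y \<partial>K z) \<partial>\<mu>)"
      unfolding SUP_mult_left_ennreal using seq.hyps(1) Fm Kf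
      by (intro nn_integral_monotone_convergence_SUP)
         (auto simp: incseq_def le_fun_def \<mu>_measurable intro!: mult_left_mono mono)
    have 2: "(\<integral>\<^sup>+p. ennreal (Fbar_f g \<mu> (fst p) * Fbar_c g \<mu> (snd p)) * (SUP i. \<integral>\<^sup>+y. U i y \<partial>K (cross p)) \<partial>(\<mu> \<Otimes>\<^sub>M \<mu>)) =
        (SUP i. \<integral>\<^sup>+p. ennreal (Fbar_f g \<mu> (fst p) * Fbar_c g \<mu> (snd p)) * (\<integral>\<^sup>+y. U i y \<partial>K (cross p)) \<partial>(\<mu> \<Otimes>\<^sub>M \<mu>))"
      unfolding SUP_mult_left_ennreal using seq.hyps(1) Fb Kc
      by (intro nn_integral_monotone_convergence_SUP)
         (auto simp: incseq_def le_fun_def \<mu>_measurable intro!: mult_left_mono mono)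
    show ?case
      unfolding SUP_nn[OF sets_Phi] SUP_nn[OF sets_K] 1 2 seq.IH
      unfolding SUP_mult_left_ennreal
      by (intro ennreal_SUP_add) (auto simp: incseq_def intro!: nn_integral_mono mult_left_mono mono)
  }
qed

lemma nn_integral_Phi_bounded:
  assumes \<phi>: "\<phi> \<in> borel_measurable borel" "\<And>z. 0 \<le> \<phi> z" "\<And>z. \<phi> z \<le> B"
  shows "(\<integral>\<^sup>+z. ennreal (\<phi> z) \<partial>Phi g K \<mu>) = ennreal (Phi_integral g K \<mu> \<phi>)"
    and "0 \<le> Phi_integral g K \<mu> \<phi>"
proof -
  have abs: "\<And>z. \<bar>\<phi> z\<bar> \<le> B" using \<phi> by simp
  have K_nonneg: "0 \<le> integral\<^sup>L (K z) \<phi>" for z using \<phi> by simp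
  have K_eq: "(\<integral>\<^sup>+y. ennreal (\<phi> y) \<partial>K z) = ennreal (integral\<^sup>L (K z) \<phi>)" for z
    using \<phi> by (intro nn_integral_eq_integral
        prob_algebra_integrable_bounded[OF prob_kernel_prob_algebra[OF K] \<phi>(1) abs]) auto
  have 1: "(\<integral>\<^sup>+z. ennreal (F_min g \<mu> z) * (\<integral>\<^sup>+y. ennreal (\<phi> y) \<partial>K z) \<partial>\<mu>) =
      ennreal (\<integral>z. F_min g \<mu> z * integral\<^sup>L (K z) \<phi> \<partial>\<mu>)"
    unfolding K_eq using weights_range K_nonneg integrable_common[OF \<phi>(1) abs]
    by (subst nn_integral_eq_integral[symmetric]) (auto simp: ennreal_mult)
  have e0: "0 \<le> excess_integral g K \<mu> \<phi>"
    unfolding excess_integral_def using weights_range K_nonneg by simp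
  have 2: "(if common_mass = 1 then 0 else ennreal (1 - common_mass)) *
      (\<integral>\<^sup>+p. ennreal (Fbar_f g \<mu> (fst p) * Fbar_c g \<mu> (snd p)) * (\<integral>\<^sup>+y. ennreal (\<phi> y) \<partial>K (cross p)) \<partial>(\<mu> \<Otimes>\<^sub>M \<mu>)) =
      ennreal (excess_integral g K \<mu> \<phi> / (1 - common_mass))"
  proof (cases "common_mass = 1")
    case False
    with common_mass_le_1 have common_mass: "0 < 1 - common_mass" by simp
    have Fbar: "Fbar_f g \<mu> z = excess_f g \<mu> z / (1 - common_mass)" "Fbar_c g \<mu> z = excess_c g \<mu> z / (1 - common_mass)" for z
      using integral_excess unfolding Fbar_f_def Fbar_c_def excess_f_def excess_c_def by simp_all
    have "ennreal (Fbar_f g \<mu> (fst p) * Fbar_c g \<mu> (snd p)) * (\<integral>\<^sup>+y. ennreal (\<phi> y) \<partial>K (cross p)) =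
        ennreal (1 / (1 - common_mass)\<^sup>2) *
        ennreal (excess_f g \<mu> (fst p) * excess_c g \<mu> (snd p) * integral\<^sup>L (K (cross p)) \<phi>)" for p
      unfolding K_eq Fbar using common_mass weights_range K_nonneg
      by (simp add: ennreal_mult[symmetric] power2_eq_square)
    moreover have "(\<integral>\<^sup>+p. ennreal (excess_f g \<mu> (fst p) * excess_c g \<mu> (snd p) * integral\<^sup>L (K (cross p)) \<phi>) \<partial>(\<mu> \<Otimes>\<^sub>M \<mu>)) =
        ennreal (excess_integral g K \<mu> \<phi>)"
      unfolding excess_integral_def using weights_range K_nonneg
      by (intro nn_integral_eq_integral integrable_excess[OF \<phi>(1) abs]) auto
    moreover have "(\<lambda>p. ennreal (excess_f g \<mu> (fst p) * excess_c g \<mu> (snd p) * integral\<^sup>L (K (cross p)) \<phi>))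
        \<in> borel_measurable (\<mu> \<Otimes>\<^sub>M \<mu>)"
      using borel_measurable_integrable[OF integrable_excess[OF \<phi>(1) abs]] by measurable
    ultimately show ?thesis
      using common_mass e0 by (simp add: nn_integral_cmult ennreal_mult[symmetric] power2_eq_square)
  qed simp
  have i1: "0 \<le> (\<integral>z. F_min g \<mu> z * integral\<^sup>L (K z) \<phi> \<partial>\<mu>)"
    using weights_range K_nonneg by simp
  have i2: "0 \<le> excess_integral g K \<mu> \<phi> / (1 - common_mass)"
    using e0 common_mass_le_1 by simp
  show "0 \<le> Phi_integral g K \<mu> \<phi>"
    using i1 i2 by (simp add: Phi_integral_def)
  show "(\<integral>\<^sup>+z. ennreal (\<phi> z) \<partial>Phi g K \<mu>) = ennreal (Phi_integral g K \<mu> \<phi>)"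
    using \<phi>(1) i1 i2 by (subst nn_integral_Phi) (simp_all add: 1 2 Phi_integral_def)
qed

lemma Phi_integral_const: "Phi_integral g K \<mu> (\<lambda>_. b) = b"
proof -
  have const: "integral\<^sup>L (K z) (\<lambda>_. b) = b" for z
    using prob_kernel_prob_algebra[OF K, of z] by (simp add: space_prob_algebra prob_space.prob_space)
  have "Phi_integral g K \<mu> (\<lambda>_. b) = b * common_mass + (1 - common_mass) * (1 - common_mass) * b / (1 - common_mass)"
    unfolding Phi_integral_def excess_integral_def const by (simp add: integral_excess_tensor)
  also have "\<dots> = b"
    by (cases "common_mass = 1") (simp_all add: field_simps)
  finally show ?thesis .
qed

lemma Phi_prob_algebra: "Phi g K \<mu> \<in> space (prob_algebra borel)"
proof -
  have "space (Phi g K \<mu>) = UNIV"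
    using sets_eq_imp_space_eq[OF sets_Phi] by simp
  then have "emeasure (Phi g K \<mu>) (space (Phi g K \<mu>)) = 1"
    using nn_integral_Phi_bounded(1)[of "\<lambda>_. 1" 1] by (simp add: Phi_integral_const)
  then show ?thesis
    by (simp add: space_prob_algebra prob_spaceI)
qed

text \<open>Adding the constant \<open>B\<close> reduces the claim to nonnegative functions.\<close>

lemma integral_Phi:
  assumes \<phi>: "\<phi> \<in> borel_measurable borel" "\<And>z. \<bar>\<phi> z\<bar> \<le> B"
  shows "integral\<^sup>L (Phi g K \<mu>) \<phi> = Phi_integral g K \<mu> \<phi>"
proof -
  interpret Phi: prob_space "Phi g K \<mu>"
    using Phi_prob_algebra by (simp add: space_prob_algebra)
  let ?\<psi> = "\<lambda>z. \<phi> z + B"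
  have \<psi>: "?\<psi> \<in> borel_measurable borel" "\<And>z. 0 \<le> ?\<psi> z" "\<And>z. ?\<psi> z \<le> 2 * B"
    using \<phi> by (auto simp: abs_le_iff) (smt (verit))+
  have int: "integrable (Phi g K \<mu>) \<phi>"
    by (rule prob_algebra_integrable_bounded[OF Phi_prob_algebra \<phi>])
  have "integral\<^sup>L (Phi g K \<mu>) ?\<psi> = Phi_integral g K \<mu> ?\<psi>"
    using nn_integral_Phi_bounded[OF \<psi>] \<psi>
    by (subst integral_eq_nn_integral) (auto cong: measurable_cong_sets)
  moreover have "integral\<^sup>L (Phi g K \<mu>) ?\<psi> = integral\<^sup>L (Phi g K \<mu>) \<phi> + B"
    using int by (simp add: Phi.prob_space)
  moreover have "Phi_integral g K \<mu> ?\<psi> = Phi_integral g K \<mu> \<phi> + Phi_integral g K \<mu> (\<lambda>_. B)"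
  proof -
    have c: "(\<lambda>_. B) \<in> borel_measurable borel" "\<And>z. \<bar>B\<bar> \<le> B"
      using order_trans[OF abs_ge_zero \<phi>(2)] by auto
    have "integral\<^sup>L (K z) ?\<psi> = integral\<^sup>L (K z) \<phi> + integral\<^sup>L (K z) (\<lambda>_. B)" for z
      using prob_algebra_integrable_bounded[OF prob_kernel_prob_algebra[OF K]] \<phi> c
      by (intro Bochner_Integration.integral_add) blast+
    then show ?thesis
      using integrable_common[OF \<phi>] integrable_common[OF c] integrable_excess[OF \<phi>] integrable_excess[OF c]
      by (simp add: Phi_integral_def excess_integral_def distrib_left add_divide_distrib)
  qed
  ultimately show ?thesis by (simp add: Phi_integral_const)
qed

end

section \<open>Weak continuity of the resampling operator\<close>

lemma uniform_limit_scale: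
  fixes f :: "'b \<Rightarrow> real"
  assumes c: "(c \<longlongrightarrow> c0) F" and f: "\<And>x. \<bar>f x\<bar> \<le> B"
  shows "uniform_limit UNIV (\<lambda>i x. f x * c i) (\<lambda>x. f x * c0) F"
proof (rule uniform_lim_mult)
  show "uniform_limit UNIV (\<lambda>i _. c i) (\<lambda>_. c0) F"
    unfolding uniform_limit_iff using c by (simp add: tendsto_iff)
  show "bounded (range f)" using f by (auto simp: bounded_iff)
qed (auto intro: uniform_limit_const)

lemma uniform_limit_min:
  fixes f g :: "'i \<Rightarrow> 'b \<Rightarrow> real"
  assumes "uniform_limit S f f0 F" "uniform_limit S g g0 F"
  shows "uniform_limit S (\<lambda>i x. min (f i x) (g i x)) (\<lambda>x. min (f0 x) (g0 x)) F"
  unfolding uniform_limit_iff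
proof (intro allI impI)
  fix e :: real assume "e > 0"
  from uniform_limitD[OF assms(1) this] uniform_limitD[OF assms(2) this]
  show "\<forall>\<^sub>F i in F. \<forall>x\<in>S. dist (min (f i x) (g i x)) (min (f0 x) (g0 x)) < e"
    by eventually_elim (fastforce simp: dist_real_def min_def abs_if split: if_splits)
qed

text \<open>The weights depend on the measure against which they are integrated, so both vary at once.\<close>

lemma tendsto_integral_uniform_limit:
  fixes \<mu> :: "'i \<Rightarrow> 'b::topological_space measure" and h :: "'i \<Rightarrow> 'b \<Rightarrow> real"
  assumes \<mu>: "\<forall>\<^sub>F i in F. \<mu> i \<in> space (prob_algebra borel)"
    and lim: "weakly_tendsto \<mu> \<nu> F"
    and unif: "uniform_limit UNIV h h0 F"
    and h0: "bounded_continuous h0"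
    and h: "\<forall>\<^sub>F i in F. h i \<in> borel_measurable borel"
  shows "((\<lambda>i. integral\<^sup>L (\<mu> i) (h i)) \<longlongrightarrow> integral\<^sup>L \<nu> h0) F"
proof -
  from h0 obtain B where B: "h0 \<in> borel_measurable borel" "\<And>x. \<bar>h0 x\<bar> \<le> B"
    by (metis bounded_continuousE)
  have "((\<lambda>i. integral\<^sup>L (\<mu> i) (h i) - integral\<^sup>L (\<mu> i) h0) \<longlongrightarrow> 0) F"
  proof (rule tendstoI)
    fix e :: real assume e: "e > 0"
    then have "e / 2 > 0" by simp
    from \<mu> h uniform_limitD[OF unif this]
    show "\<forall>\<^sub>F i in F. dist (integral\<^sup>L (\<mu> i) (h i) - integral\<^sup>L (\<mu> i) h0) 0 < e"
    proof eventually_elim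
      case (elim i)
      then have d: "\<bar>h i x - h0 x\<bar> \<le> e / 2" for x
        by (simp add: dist_real_def less_imp_le)
      have "\<bar>h i x\<bar> \<le> B + e / 2" for x
        using d[of x] B(2)[of x] by linarith
      from prob_algebra_integrable_bounded[OF elim(1,2) this] prob_algebra_integrable_bounded[OF elim(1) B]
      have "integral\<^sup>L (\<mu> i) (h i) - integral\<^sup>L (\<mu> i) h0 = (\<integral>x. h i x - h0 x \<partial>\<mu> i)"
        by simp
      also have "\<bar>\<dots>\<bar> \<le> e / 2"
        using elim B by (intro prob_algebra_integral_bounded d) auto
      finally show ?case using e by simp
    qed
  qed
  moreover have "((\<lambda>i. integral\<^sup>L (\<mu> i) h0) \<longlongrightarrow> integral\<^sup>L \<nu> h0) F"
    using lim h0 by (simp add: weakly_tendsto_def)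
  ultimately show ?thesis
    using tendsto_add by fastforce
qed

context coupled_resampling
begin

lemma weights_bounded_continuous:
  assumes g: "continuous_on UNIV g"
  shows "bounded_continuous (F_min g \<mu>)" "bounded_continuous (excess_f g \<mu>)"
    "bounded_continuous (excess_c g \<mu>)"
proof -
  have "continuous_on UNIV (\<lambda>z. g (fst z))" "continuous_on UNIV (\<lambda>z. g (snd z))"
    by (intro continuous_on_compose2[OF g] continuous_intros; simp)+
  then have "continuous_on UNIV (F_f g \<mu>)" "continuous_on UNIV (F_c g \<mu>)"
    unfolding F_f_def[abs_def] F_c_def[abs_def] using f_pos c_pos by (auto intro!: continuous_intros)
  then have "continuous_on UNIV (F_min g \<mu>)" "continuous_on UNIV (excess_f g \<mu>)"
    "continuous_on UNIV (excess_c g \<mu>)"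
    unfolding F_min_def[abs_def] excess_f_def[abs_def] excess_c_def[abs_def]
    by (auto intro!: continuous_intros)
  then show "bounded_continuous (F_min g \<mu>)" "bounded_continuous (excess_f g \<mu>)"
    "bounded_continuous (excess_c g \<mu>)"
    by (auto intro: bounded_continuousI weights_abs)
qed

end

text \<open>
  The weights are \<open>g\<close> divided by integrals that converge to positive limits, hence converge
  uniformly, and so do their minimum and the residual weights. Together with the Feller property this
  gives the limits of the common part and of the numerator of the residual part, the latter being an integral
  against \<open>\<mu> i \<Otimes>\<^sub>M \<mu> i\<close>.
\<close>

lemma weakly_tendsto_Phi:
  fixes g :: "'a::{metric_space, second_countable_topology} \<Rightarrow> real"
  assumes g: "continuous_on UNIV g"
    and K: "feller K"
    and \<mu>: "\<forall>\<^sub>F i in F. coupled_resampling g C K (\<mu> i)"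
    and \<nu>: "coupled_resampling g C K \<nu>"
    and lim: "weakly_tendsto \<mu> \<nu> F"
  shows "weakly_tendsto (\<lambda>i. Phi g K (\<mu> i)) (Phi g K \<nu>) F"
  unfolding weakly_tendsto_def
proof (intro allI impI)
  fix \<phi> :: "'a \<times> 'a \<Rightarrow> real"
  assume \<phi>_bc: "bounded_continuous \<phi>"
  then obtain B where \<phi>: "\<phi> \<in> borel_measurable borel" "\<And>z. \<bar>\<phi> z\<bar> \<le> B"
    by (metis bounded_continuousE)
  interpret \<nu>: coupled_resampling g C K \<nu> by (rule \<nu>)
  note [measurable] = \<nu>.g_measurable
  have \<mu>_prob: "\<forall>\<^sub>F i in F. \<mu> i \<in> space (prob_algebra borel)"
    using \<mu> by eventually_elim (simp add: coupled_resampling.\<mu>)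
  have \<mu>\<mu>_prob: "\<forall>\<^sub>F i in F. \<mu> i \<Otimes>\<^sub>M \<mu> i \<in> space (prob_algebra borel)"
    using \<mu>_prob by eventually_elim (rule prob_algebra_pair)
  have g_bc: "bounded_continuous g"
    using \<nu>.g_nonneg \<nu>.g_le by (intro bounded_continuousI[OF g, of C]) simp
  have g_abs: "\<bar>g x\<bar> \<le> C" for x
    using \<nu>.g_nonneg \<nu>.g_le by simp

  have F_f: "uniform_limit UNIV (\<lambda>i. F_f g (\<mu> i)) (F_f g \<nu>) F"
    unfolding F_f_def[abs_def] divide_inverse
  proof (intro uniform_limit_scale tendsto_inverse)
    show "((\<lambda>i. \<integral>z. g (fst z) \<partial>\<mu> i) \<longlongrightarrow> (\<integral>z. g (fst z) \<partial>\<nu>)) F"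
      using lim bounded_continuous_compose[OF g_bc, of "fst :: 'a \<times> 'a \<Rightarrow> 'a"]
      by (simp add: weakly_tendsto_def continuous_on_fst)
  qed (use \<nu>.f_pos g_abs in auto)
  have F_c: "uniform_limit UNIV (\<lambda>i. F_c g (\<mu> i)) (F_c g \<nu>) F"
    unfolding F_c_def[abs_def] divide_inverse
  proof (intro uniform_limit_scale tendsto_inverse)
    show "((\<lambda>i. \<integral>z. g (snd z) \<partial>\<mu> i) \<longlongrightarrow> (\<integral>z. g (snd z) \<partial>\<nu>)) F"
      using lim bounded_continuous_compose[OF g_bc, of "snd :: 'a \<times> 'a \<Rightarrow> 'a"]
      by (simp add: weakly_tendsto_def continuous_on_snd)
  qed (use \<nu>.c_pos g_abs in auto)
  have F_min: "uniform_limit UNIV (\<lambda>i. F_min g (\<mu> i)) (F_min g \<nu>) F"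
    unfolding F_min_def[abs_def] by (rule uniform_limit_min[OF F_f F_c])
  have excess: "uniform_limit UNIV (\<lambda>i. excess_f g (\<mu> i)) (excess_f g \<nu>) F"
    "uniform_limit UNIV (\<lambda>i. excess_c g (\<mu> i)) (excess_c g \<nu>) F"
    unfolding excess_f_def[abs_def] excess_c_def[abs_def]
    by (intro uniform_limit_minus F_f F_c F_min)+

  define k where "k z = integral\<^sup>L (K z) \<phi>" for z
  have k_bc: "bounded_continuous k"
    using K \<phi>_bc unfolding feller_def k_def by blast
  have k_meas[measurable]: "k \<in> borel_measurable borel"
    unfolding k_def[abs_def] by (rule kernel_integral_measurable[OF \<nu>.K \<phi>(1)])
  have kc_bc: "bounded_continuous (\<lambda>p. k (cross p))"
    by (rule bounded_continuous_compose[OF k_bc continuous_on_cross])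
  note bc = \<nu>.weights_bounded_continuous[OF g]
  have bdd: "bounded (range f)" if "bounded_continuous f" for f :: "'z::topological_space \<Rightarrow> real"
    using that by (simp add: bounded_continuous_def)

  have m: "((\<lambda>i. \<integral>z. F_min g (\<mu> i) z \<partial>\<mu> i) \<longlongrightarrow> \<nu>.common_mass) F"
    by (rule tendsto_integral_uniform_limit[OF \<mu>_prob lim F_min bc(1)]) simp
  have common: "((\<lambda>i. \<integral>z. F_min g (\<mu> i) z * k z \<partial>\<mu> i) \<longlongrightarrow> (\<integral>z. F_min g \<nu> z * k z \<partial>\<nu>)) F"
    by (intro tendsto_integral_uniform_limit[OF \<mu>_prob lim] uniform_lim_mult F_min uniform_limit_const
        bounded_continuous_mult bc k_bc bdd always_eventually allI borel_measurable_times
        F_min_measurable \<nu>.g_measurable k_meas)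
  have tensor_bc: "bounded_continuous (\<lambda>p. excess_f g \<nu> (fst p) * excess_c g \<nu> (snd p))"
    by (intro bounded_continuous_mult bounded_continuous_compose[OF bc(2)]
        bounded_continuous_compose[OF bc(3)] continuous_intros)
  have tensor: "uniform_limit UNIV (\<lambda>i p. excess_f g (\<mu> i) (fst p) * excess_c g (\<mu> i) (snd p))
      (\<lambda>p. excess_f g \<nu> (fst p) * excess_c g \<nu> (snd p)) F"
    by (intro uniform_lim_mult uniform_limit_compose'[OF excess(1)] uniform_limit_compose'[OF excess(2)]
        bdd bounded_continuous_compose[OF bc(2)] bounded_continuous_compose[OF bc(3)]
        continuous_intros) auto
  have "((\<lambda>i. excess_integral g K (\<mu> i) \<phi>) \<longlongrightarrow> excess_integral g K \<nu> \<phi>) F"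
    unfolding excess_integral_def k_def[symmetric]
    by (intro tendsto_integral_uniform_limit[OF \<mu>\<mu>_prob weakly_tendsto_pair[OF \<mu>_prob \<nu>.\<mu> lim]]
        uniform_lim_mult[OF tensor uniform_limit_const] bdd tensor_bc kc_bc bounded_continuous_mult
        always_eventually allI borel_measurable_times tensor_measurable excess_measurable \<nu>.g_measurable
        measurable_compose[OF cross_measurable k_meas])
  note excess_lim = this

  have residual: "((\<lambda>i. excess_integral g K (\<mu> i) \<phi> / (1 - (\<integral>z. F_min g (\<mu> i) z \<partial>\<mu> i)))
      \<longlongrightarrow> excess_integral g K \<nu> \<phi> / (1 - \<nu>.common_mass)) F"
  proof (cases "\<nu>.common_mass = 1")
    case False
    then show ?thesis by (intro tendsto_divide excess_lim tendsto_diff tendsto_const m) simp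
  next
    case True
    \<comment> \<open>The denominator tends to \<open>0\<close>, but the quotient is bounded by a multiple of it.\<close>
    have "\<forall>\<^sub>F i in F. norm (excess_integral g K (\<mu> i) \<phi> / (1 - (\<integral>z. F_min g (\<mu> i) z \<partial>\<mu> i)))
        \<le> B * (1 - (\<integral>z. F_min g (\<mu> i) z \<partial>\<mu> i))"
      using \<mu> by eventually_elim
        (simp only: real_norm_def coupled_resampling.excess_integral_bounded[OF _ \<phi>])
    moreover have "((\<lambda>i. B * (1 - (\<integral>z. F_min g (\<mu> i) z \<partial>\<mu> i))) \<longlongrightarrow> B * (1 - \<nu>.common_mass)) F"
      by (intro tendsto_intros m)
    ultimately show ?thesis
      using True by (auto intro: Lim_null_comparison)
  qed
  have "((\<lambda>i. Phi_integral g K (\<mu> i) \<phi>) \<longlongrightarrow> Phi_integral g K \<nu> \<phi>) F"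
    unfolding Phi_integral_def using tendsto_add[OF common residual] by (simp add: k_def)
  moreover have "\<forall>\<^sub>F i in F. Phi_integral g K (\<mu> i) \<phi> = integral\<^sup>L (Phi g K (\<mu> i)) \<phi>"
    using \<mu> by eventually_elim (simp add: coupled_resampling.integral_Phi[OF _ \<phi>])
  ultimately show "((\<lambda>i. integral\<^sup>L (Phi g K (\<mu> i)) \<phi>) \<longlongrightarrow> integral\<^sup>L (Phi g K \<nu>) \<phi>) F"
    by (simp add: \<nu>.integral_Phi[OF \<phi>] tendsto_cong)
qed

lemma tendsto_whp_cong_AE:
  fixes X :: "nat \<Rightarrow> 'w \<Rightarrow> real"
  assumes "((\<lambda>(N, \<omega>). X N \<omega>) \<longlongrightarrow> c) (whp P)"
    and "\<And>N. 1 \<le> N \<Longrightarrow> AE \<omega> in P N. X N \<omega> = Y N \<omega>"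
  shows "((\<lambda>(N, \<omega>). Y N \<omega>) \<longlongrightarrow> c) (whp P)"
proof -
  have "\<forall>\<^sub>F x in whp P. (case x of (N, \<omega>) \<Rightarrow> X N \<omega>) = (case x of (N, \<omega>) \<Rightarrow> Y N \<omega>)"
    by (rule eventually_whpI_AE) (use assms(2) in simp)
  with assms(1) show ?thesis by (simp add: tendsto_cong)
qed

section \<open>Convergence of the particle filter\<close>

theorem theorem3p1:
  fixes G :: "nat \<Rightarrow> 'a::{metric_space, second_countable_topology} \<Rightarrow> real"
    and \<eta>0_f \<eta>0_c :: "'a measure"
    and M_f M_c :: "nat \<Rightarrow> 'a \<Rightarrow> 'a measure"
    and \<eta>0 :: "('a \<times> 'a) measure"
    and M :: "nat \<Rightarrow> 'a \<times> 'a \<Rightarrow> ('a \<times> 'a) measure"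
    and P :: "nat \<Rightarrow> 'w measure"
    and u :: "nat \<Rightarrow> nat \<Rightarrow> nat \<Rightarrow> 'w \<Rightarrow> 'a \<times> 'a"
  assumes model: "coupled_model G \<eta>0_f \<eta>0_c M_f M_c \<eta>0 M"
    and particles: "\<And>N. 1 \<le> N \<Longrightarrow> particle_filter (P N) G \<eta>0 M N (u N)"
    and limit_pos: "\<And>n. (\<integral>z. G n (fst z) \<partial>(eta G M \<eta>0 n)) > 0"
      "\<And>n. (\<integral>z. G n (snd z) \<partial>(eta G M \<eta>0 n)) > 0"
    and particle_pos:
      "\<And>N n. 1 \<le> N \<Longrightarrow>
        AE \<omega> in P N. (\<integral>z. G n (fst z) \<partial>(empirical N (\<lambda>i. u N n i \<omega>))) > 0"
      "\<And>N n. 1 \<le> N \<Longrightarrow>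
        AE \<omega> in P N. (\<integral>z. G n (snd z) \<partial>(empirical N (\<lambda>i. u N n i \<omega>))) > 0"
    and G_continuous: "\<And>n. bounded_continuous (G n)"
    and M_feller: "\<And>n. 1 \<le> n \<Longrightarrow> feller (M n)"
    and loc_compact: "locally_compact_space (euclidean :: ('a \<times> 'a) topology)"
  shows "\<forall>n. \<forall>\<phi> :: 'a \<times> 'a \<Rightarrow> real. bounded_continuous \<phi> \<longrightarrow>
    converges_in_prob P (\<lambda>N \<omega>. integral\<^sup>L (empirical N (\<lambda>i. u N n i \<omega>)) \<phi>)
      (integral\<^sup>L (eta G M \<eta>0 n) \<phi>)"
proof -
  interpret coupled_model G \<eta>0_f \<eta>0_c M_f M_c \<eta>0 M by (rule model)
  have P: "prob_space (P N)" if "1 \<le> N" for N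
    using particles[OF that] by (simp add: particle_filter_def)
  define \<mu> where "\<mu> n = (\<lambda>(N, \<omega>). empirical N (\<lambda>i. u N n i \<omega>))" for n
  have \<mu>_prob: "\<forall>\<^sub>F x in whp P. \<mu> n x \<in> space (prob_algebra borel)" for n
    by (rule eventually_whpI_AE) (simp add: \<mu>_def empirical_prob_algebra)
  have "\<exists>c. \<forall>x. G n x \<le> c" for n
    using G_continuous[of n] by (metis abs_le_D1 bounded_continuousE)
  then obtain C where C: "\<And>n x. G n x \<le> C n" by metis
  have resampling: "coupled_resampling (G n) (C n) (M (Suc n)) \<rho>"
    if "\<rho> \<in> space (prob_algebra borel)" "(\<integral>z. G n (fst z) \<partial>\<rho>) > 0" "(\<integral>z. G n (snd z) \<partial>\<rho>) > 0" for n \<rho>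
    by unfold_locales (use that C G_nonneg G_measurable M in auto)
  have \<eta>_prob: "eta G M \<eta>0 n \<in> space (prob_algebra borel)" for n
  proof (induction n)
    case (Suc n)
    from coupled_resampling.Phi_prob_algebra[OF resampling[OF Suc limit_pos]]
    show ?case by simp
  qed (simp add: \<eta>0)
  have \<mu>_resampling: "AE \<omega> in P N. coupled_resampling (G n) (C n) (M (Suc n)) (\<mu> n (N, \<omega>))"
    if N: "1 \<le> N" for N n
    using particle_pos[OF N, of n]
    by eventually_elim (simp add: \<mu>_def resampling empirical_prob_algebra[OF N])

  \<comment> \<open>Law of large numbers: each generation is close to the law from which it is sampled.\<close>
  have initial: "((\<lambda>x. measure (\<mu> 0 x) B - measure \<eta>0 B) \<longlongrightarrow> 0) (whp P)"
    if B: "B \<in> sets borel" for B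
  proof -
    have "((\<lambda>(N, \<omega>). measure (empirical N (\<lambda>i. u N 0 i \<omega>)) B - measure \<eta>0 B) \<longlongrightarrow> 0) (whp P)"
      by (rule tendsto_whp_0_if_second_moment[OF _ _ lim_1_over_n])
         (rule particle_filter.initial_second_moment[OF particles _ B]; assumption)+
    then show ?thesis by (simp add: \<mu>_def case_prod_beta')
  qed
  have transition: "((\<lambda>x. measure (\<mu> (Suc n) x) B - measure (Phi (G n) (M (Suc n)) (\<mu> n x)) B) \<longlongrightarrow> 0) (whp P)"
    if B: "B \<in> sets borel" for B n
  proof -
    let ?Q = "\<lambda>N \<omega>. Phi (G n) (M (Suc n)) (empirical N (\<lambda>i. u N n i \<omega>))"
    let ?e = "\<lambda>N \<omega>. measure (empirical N (\<lambda>i. u N (Suc n) i \<omega>)) B"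
    let ?good = "\<lambda>N q. (AE \<omega> in P N. q \<omega> = measure (?Q N \<omega>) B) \<and>
      integrable (P N) (\<lambda>\<omega>. (?e N \<omega> - q \<omega>)\<^sup>2) \<and> (\<integral>\<omega>. (?e N \<omega> - q \<omega>)\<^sup>2 \<partial>P N) \<le> 1 / N"
    have "\<exists>q. ?good N q" if N: "1 \<le> N" for N
    proof -
      have "AE \<omega> in P N. ?Q N \<omega> \<in> space (prob_algebra borel)"
        using \<mu>_resampling[OF N, of n]
        by eventually_elim (simp add: \<mu>_def coupled_resampling.Phi_prob_algebra)
      from particle_filter.transition_second_moment[OF particles[OF N] N B this]
      show ?thesis by blast
    qed
    then have "\<forall>N. \<exists>q. 1 \<le> N \<longrightarrow> ?good N q" by blast
    from choice[OF this] obtain q where q: "\<And>N. 1 \<le> N \<Longrightarrow> AE \<omega> in P N. q N \<omega> = measure (?Q N \<omega>) B"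
      "\<And>N. 1 \<le> N \<Longrightarrow> integrable (P N) (\<lambda>\<omega>. (?e N \<omega> - q N \<omega>)\<^sup>2)"
      "\<And>N. 1 \<le> N \<Longrightarrow> (\<integral>\<omega>. (?e N \<omega> - q N \<omega>)\<^sup>2 \<partial>P N) \<le> 1 / N"
      by blast
    have "((\<lambda>(N, \<omega>). ?e N \<omega> - measure (?Q N \<omega>) B) \<longlongrightarrow> 0) (whp P)"
    proof (rule tendsto_whp_cong_AE)
      show "((\<lambda>(N, \<omega>). ?e N \<omega> - q N \<omega>) \<longlongrightarrow> 0) (whp P)"
        by (rule tendsto_whp_0_if_second_moment[OF q(2,3) lim_1_over_n])
      show "AE \<omega> in P N. ?e N \<omega> - q N \<omega> = ?e N \<omega> - measure (?Q N \<omega>) B" if "1 \<le> N" for N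
        using q(1)[OF that] by eventually_elim simp
    qed
    then show ?thesis by (simp add: \<mu>_def case_prod_beta')
  qed

  \<comment> \<open>Propagation in time: sampling error plus weak continuity of the operator.\<close>
  have weak: "weakly_tendsto (\<mu> n) (eta G M \<eta>0 n) (whp P)" for n
  proof (induction n)
    case 0
    show ?case
      unfolding weakly_tendsto_def
    proof (intro allI impI)
      fix \<phi> :: "'a \<times> 'a \<Rightarrow> real" assume "bounded_continuous \<phi>"
      then obtain B where \<phi>: "\<phi> \<in> borel_measurable borel" "\<And>z. \<bar>\<phi> z\<bar> \<le> B"
        by (metis bounded_continuousE)
      from tendsto_integral_diff_if_tendsto_measure_diff[OF \<mu>_prob _ initial \<phi>]
      have "((\<lambda>x. integral\<^sup>L (\<mu> 0 x) \<phi> - integral\<^sup>L \<eta>0 \<phi>) \<longlongrightarrow> 0) (whp P)"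
        using \<eta>0 by simp
      then show "((\<lambda>x. integral\<^sup>L (\<mu> 0 x) \<phi>) \<longlongrightarrow> integral\<^sup>L (eta G M \<eta>0 0) \<phi>) (whp P)"
        by (simp add: Lim_null[symmetric])
    qed
  next
    case (Suc n)
    let ?Q = "\<lambda>x. Phi (G n) (M (Suc n)) (\<mu> n x)"
    have r: "\<forall>\<^sub>F x in whp P. coupled_resampling (G n) (C n) (M (Suc n)) (\<mu> n x)"
      by (rule eventually_whpI_AE) (rule \<mu>_resampling)
    then have Q_prob: "\<forall>\<^sub>F x in whp P. ?Q x \<in> space (prob_algebra borel)"
      by eventually_elim (rule coupled_resampling.Phi_prob_algebra)
    have Q_lim: "weakly_tendsto ?Q (eta G M \<eta>0 (Suc n)) (whp P)"
      using weakly_tendsto_Phi[OF _ M_feller r resampling[OF \<eta>_prob limit_pos] Suc] G_continuous[of n]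
      by (simp add: bounded_continuous_def)
    show ?case
      unfolding weakly_tendsto_def
    proof (intro allI impI)
      fix \<phi> :: "'a \<times> 'a \<Rightarrow> real" assume bc: "bounded_continuous \<phi>"
      then obtain B where \<phi>: "\<phi> \<in> borel_measurable borel" "\<And>z. \<bar>\<phi> z\<bar> \<le> B"
        by (metis bounded_continuousE)
      have "((\<lambda>x. integral\<^sup>L (\<mu> (Suc n) x) \<phi> - integral\<^sup>L (?Q x) \<phi>) \<longlongrightarrow> 0) (whp P)"
        by (rule tendsto_integral_diff_if_tendsto_measure_diff[OF \<mu>_prob Q_prob transition \<phi>])
      moreover have "((\<lambda>x. integral\<^sup>L (?Q x) \<phi>) \<longlongrightarrow> integral\<^sup>L (eta G M \<eta>0 (Suc n)) \<phi>) (whp P)"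
        using Q_lim bc by (simp only: weakly_tendsto_def)
      ultimately show "((\<lambda>x. integral\<^sup>L (\<mu> (Suc n) x) \<phi>) \<longlongrightarrow> integral\<^sup>L (eta G M \<eta>0 (Suc n)) \<phi>) (whp P)"
        using tendsto_add by fastforce
    qed
  qed
  show ?thesis
  proof (intro allI impI converges_in_prob_if_tendsto_whp P)
    fix n and \<phi> :: "'a \<times> 'a \<Rightarrow> real" assume "bounded_continuous \<phi>"
    with weak[of n] show "((\<lambda>(N, \<omega>). integral\<^sup>L (empirical N (\<lambda>i. u N n i \<omega>)) \<phi>)
        \<longlongrightarrow> integral\<^sup>L (eta G M \<eta>0 n) \<phi>) (whp P)"
      by (simp add: weakly_tendsto_def \<mu>_def case_prod_beta')
  qed
qed

end
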